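(* Let $p$ be a prime and let $A$ be a $\mathbb Z_p$-binomial $\cup_1$-dga, with $Z^1(A)=\{a\in A^1: da=0\}$. Then for each $a\in Z^1(A)$ and each integer $k$ with $1\le k\le p-1$, $$d\zeta_k(a)=-\sum_{\ell=1}^{k-1}\zeta_\ell(a)\cup\zeta_{k-\ell}(a).$$ More generally, if $I=(k_1,\dots,k_n)$ with $1\le k_i\le p-1$ and $\mathbf a=(a_1,\dots,a_n)$ with $a_i\in Z^1(A)$, then $$d(\zeta_I(\mathbf a))=-\sum_{\substack{I_1+I_2=I\\ I_j\ne\mathbf 0}}\zeta_{I_1}(\mathbf a)\cup\zeta_{I_2}(\mathbf a),$$ where the sum is over pairs of non-zero $n$-tuples of non-negative integers $I_1,I_2$ with $I_1+I_2=I$.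
   Context: $\mathbb Z_p=\mathbb Z/p\mathbb Z$. A $\mathbb Z_p$-binomial algebra is a commutative $\mathbb Z_p$-algebra $B$ (with injective structure map $\mathbb Z_p\to B$) such that $b(b-1)\cdots(b-n+1)=0$ for all $n\ge p$ and all $b\in B$. In it, $\zeta_n(b)=b(b-1)\cdots(b-n+1)/n!$ for $1\le n\le p-1$, and $\zeta_0(b)=1$. Graded $R$-algebras $A=\bigoplus_{i\ge0}A^i$ (here $R=\mathbb Z_p$) are associative and unital, with injective structure map $R\to A$, so that $R\subset A^0$; the product is denoted $a\cup b$. A differential graded $R$-algebra is a graded $R$-algebra with an $R$-linear degree $1$ map $d$ with $d^2=0$ and $d(a\cup b)=da\cup b+(-1)^{|a|}a\cup db$ for homogeneous $a,b$. $D^2(A)\subseteq A^2$ is the $R$-submodule spanned by all $a\cup b$ with $a,b\in A^1$. A graded algebra with cup-one products is a graded $R$-algebra $A$ with $R$-linear maps $\cup_1\colon A^p\otimes_R A^1\to A^p$ for degrees $p=1,2$ such that (i) $(a\cup b)\cup_1 c=a\cup(b\cup_1 c)+(a\cup_1 c)\cup b$ for all $a,b,c\in A^1$; (ii) the $R$-module $R\oplus A^1$, with multiplication $(r+a)(s+b)=rs+(rb+sa+a\cup_1 b)$, is a commutative ring. A $\mathbb Z_p$-binomial $\cup_1$-dga is a differential graded $\mathbb Z_p$-algebra $(A,d)$ such that: $A$ is a graded $\mathbb Z_p$-algebra with cup-one products; there is a linear map $\circ\colon D^2(A)\otimes D^2(A)\to D^2(A)$ with $(u\cup v)\circ(w\cup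 z)=(u\cup_1 w)\cup(v\cup_1 z)$ for $u,v,w,z\in A^1$, and $d(a\cup_1 b)=-a\cup b-b\cup a+da\cup_1 b+db\cup_1 a-da\circ db$ for all $a,b\in A^1$ with $da,db\in D^2(A)$; and $\mathbb Z_p\oplus A^1$, with multiplication on $A^1$ given by the cup-one product, is a $\mathbb Z_p$-binomial algebra. For $\mathbf a=(a_1,\dots,a_n)$ and $I=(i_1,\dots,i_n)$ with $0\le i_j\le p-1$, $\zeta_I(\mathbf a)=\zeta_{i_1}(a_1)\cdots\zeta_{i_n}(a_n)$, the product being taken in $\mathbb Z_p\oplus A^1$. *)

theory Defs
  imports "HOL-Algebra.Module" "HOL-Number_Theory.Residues"
begin

abbreviation Zp :: "nat \<Rightarrow> int ring" where
  "Zp p \<equiv> residue_ring (int p)"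

text \<open>\<open>R\<close>-linear maps out of a tensor product \<open>U \<otimes> V\<close> are given as \<open>R\<close>-bilinear maps
  on \<open>U \<times> V\<close>; their values off \<open>U \<times> V\<close> are irrelevant.\<close>

definition bilinear_on ::
  "('r, 'k) ring_scheme \<Rightarrow> ('r, 'a, 'm) module_scheme \<Rightarrow> 'a set \<Rightarrow> 'a set \<Rightarrow> 'a set \<Rightarrow>
   ('a \<Rightarrow> 'a \<Rightarrow> 'a) \<Rightarrow> bool" where
  "bilinear_on R A U V W f \<longleftrightarrow>
     (\<forall>u\<in>U. \<forall>v\<in>V. f u v \<in> W) \<and>
     (\<forall>u\<in>U. \<forall>u'\<in>U. \<forall>v\<in>V. f (u \<oplus>\<^bsub>A\<^esub> u') v = f u v \<oplus>\<^bsub>A\<^esub> f u' v) \<and>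
     (\<forall>u\<in>U. \<forall>v\<in>V. \<forall>v'\<in>V. f u (v \<oplus>\<^bsub>A\<^esub> v') = f u v \<oplus>\<^bsub>A\<^esub> f u v') \<and>
     (\<forall>r\<in>carrier R. \<forall>u\<in>U. \<forall>v\<in>V. f (r \<odot>\<^bsub>A\<^esub> u) v = r \<odot>\<^bsub>A\<^esub> f u v) \<and>
     (\<forall>r\<in>carrier R. \<forall>u\<in>U. \<forall>v\<in>V. f u (r \<odot>\<^bsub>A\<^esub> v) = r \<odot>\<^bsub>A\<^esub> f u v)"

text \<open>The cup product is the multiplication \<open>\<otimes>\<^bsub>A\<^esub>\<close>, and \<open>G i\<close> is the degree \<open>i\<close> part \<open>A\<^sup>i\<close>.
  The library's locale \<open>algebra\<close> is not used here because it requires commutativity.\<close>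

locale graded_algebra = module R A + ring A
  for R (structure) and A :: "('r, 'a, 'm) module_scheme" (structure) +
  fixes G :: "nat \<Rightarrow> 'a set"
  assumes smult_mult_left:
      "\<lbrakk>r \<in> carrier R; x \<in> carrier A; y \<in> carrier A\<rbrakk> \<Longrightarrow>
        (r \<odot>\<^bsub>A\<^esub> x) \<otimes>\<^bsub>A\<^esub> y = r \<odot>\<^bsub>A\<^esub> (x \<otimes>\<^bsub>A\<^esub> y)"
    and smult_mult_right:
      "\<lbrakk>r \<in> carrier R; x \<in> carrier A; y \<in> carrier A\<rbrakk> \<Longrightarrow>
        x \<otimes>\<^bsub>A\<^esub> (r \<odot>\<^bsub>A\<^esub> y) = r \<odot>\<^bsub>A\<^esub> (x \<otimes>\<^bsub>A\<^esub> y)"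
    and inj_structure_map: "inj_on (\<lambda>r. r \<odot>\<^bsub>A\<^esub> \<one>\<^bsub>A\<^esub>) (carrier R)"
    and graded_submodule: "submodule (G i) R A"
    and direct_sum:
      "x \<in> carrier A \<Longrightarrow>
        \<exists>!f. (\<forall>i. f i \<in> G i) \<and> finite {i. f i \<noteq> \<zero>\<^bsub>A\<^esub>} \<and>
             x = (\<Oplus>\<^bsub>A\<^esub>i\<in>{i. f i \<noteq> \<zero>\<^bsub>A\<^esub>}. f i)"
    and graded_one: "\<one>\<^bsub>A\<^esub> \<in> G 0"
    and graded_mult: "\<lbrakk>a \<in> G i; b \<in> G j\<rbrakk> \<Longrightarrow> a \<otimes>\<^bsub>A\<^esub> b \<in> G (i + j)"

locale dg_algebra = graded_algebra R A G
  for R (structure) and A :: "('r, 'a, 'm) module_scheme" (structure) and G +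
  fixes d :: "'a \<Rightarrow> 'a"
  assumes d_add: "\<lbrakk>x \<in> carrier A; y \<in> carrier A\<rbrakk> \<Longrightarrow> d (x \<oplus>\<^bsub>A\<^esub> y) = d x \<oplus>\<^bsub>A\<^esub> d y"
    and d_smult: "\<lbrakk>r \<in> carrier R; x \<in> carrier A\<rbrakk> \<Longrightarrow> d (r \<odot>\<^bsub>A\<^esub> x) = r \<odot>\<^bsub>A\<^esub> d x"
    and d_degree: "a \<in> G i \<Longrightarrow> d a \<in> G (Suc i)"
    and d_square: "x \<in> carrier A \<Longrightarrow> d (d x) = \<zero>\<^bsub>A\<^esub>"
    and d_Leibniz:
      "\<lbrakk>a \<in> G i; b \<in> G j\<rbrakk> \<Longrightarrow>
        d (a \<otimes>\<^bsub>A\<^esub> b) = d a \<otimes>\<^bsub>A\<^esub> b \<oplus>\<^bsub>A\<^esub> ((\<ominus>\<^bsub>A\<^esub> \<one>\<^bsub>A\<^esub>) [^]\<^bsub>A\<^esub> i) \<otimes>\<^bsub>A\<^esub> (a \<otimes>\<^bsub>A\<^esub> d b)"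

definition decomposables2 ::
  "('r, 'k) ring_scheme \<Rightarrow> ('r, 'a, 'm) module_scheme \<Rightarrow> (nat \<Rightarrow> 'a set) \<Rightarrow> 'a set" where
  "decomposables2 R A G =
     \<Inter>{N. submodule N R A \<and> {a \<otimes>\<^bsub>A\<^esub> b | a b. a \<in> G 1 \<and> b \<in> G 1} \<subseteq> N}"

text \<open>The \<open>R\<close>-module \<open>R \<oplus> A\<^sup>1\<close> with multiplication
  \<open>(r + a)(s + b) = rs + (rb + sa + a \<union>\<^sub>1 b)\<close>; here \<open>r + a\<close> is the pair \<open>(r, a)\<close>.\<close>

definition cup_one_ring ::
  "('r, 'k) ring_scheme \<Rightarrow> ('r, 'a, 'm) module_scheme \<Rightarrow> (nat \<Rightarrow> 'a set) \<Rightarrow>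
   ('a \<Rightarrow> 'a \<Rightarrow> 'a) \<Rightarrow> ('r, 'r \<times> 'a) module" where
  "cup_one_ring R A G cup1 =
     \<lparr>carrier = carrier R \<times> G 1,
      monoid.mult = (\<lambda>(r, a) (s, b).
        (r \<otimes>\<^bsub>R\<^esub> s, r \<odot>\<^bsub>A\<^esub> b \<oplus>\<^bsub>A\<^esub> s \<odot>\<^bsub>A\<^esub> a \<oplus>\<^bsub>A\<^esub> cup1 a b)),
      one = (\<one>\<^bsub>R\<^esub>, \<zero>\<^bsub>A\<^esub>),
      zero = (\<zero>\<^bsub>R\<^esub>, \<zero>\<^bsub>A\<^esub>),
      add = (\<lambda>(r, a) (s, b). (r \<oplus>\<^bsub>R\<^esub> s, a \<oplus>\<^bsub>A\<^esub> b)),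
      smult = (\<lambda>r (s, b). (r \<otimes>\<^bsub>R\<^esub> s, r \<odot>\<^bsub>A\<^esub> b))\<rparr>"

text \<open>One function \<open>cup1\<close> serves both degrees 1 and 2: \<open>A\<^sup>1\<close> and \<open>A\<^sup>2\<close> meet only in 0,
  where bilinearity makes both maps vanish.\<close>

locale cup_one_algebra = graded_algebra R A G
  for R (structure) and A :: "('r, 'a, 'm) module_scheme" (structure) and G +
  fixes cup1 :: "'a \<Rightarrow> 'a \<Rightarrow> 'a"
  assumes cup1_bilinear: "i \<in> {1, 2} \<Longrightarrow> bilinear_on R A (G i) (G 1) (G i) cup1"
    and cup1_Hirsch:
      "\<lbrakk>a \<in> G 1; b \<in> G 1; c \<in> G 1\<rbrakk> \<Longrightarrow>
        cup1 (a \<otimes>\<^bsub>A\<^esub> b) c = a \<otimes>\<^bsub>A\<^esub> cup1 b c \<oplus>\<^bsub>A\<^esub> cup1 a c \<otimes>\<^bsub>A\<^esub> b"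
    and cup1_cring: "cring (cup_one_ring R A G cup1)"

text \<open>\<open>b (b - 1) \<dots> (b - n + 1)\<close>\<close>

definition falling :: "('b, 'm) ring_scheme \<Rightarrow> nat \<Rightarrow> 'b \<Rightarrow> 'b" where
  "falling B n b = (\<Otimes>\<^bsub>B\<^esub>i\<in>{..<n}. b \<ominus>\<^bsub>B\<^esub> ([i] \<cdot>\<^bsub>B\<^esub> \<one>\<^bsub>B\<^esub>))"

locale Zp_binomial_algebra = algebra "Zp p" B
  for p :: nat and B :: "(int, 'b, 'm) module_scheme" (structure) +
  assumes inj_structure_map: "inj_on (\<lambda>r. r \<odot>\<^bsub>B\<^esub> \<one>\<^bsub>B\<^esub>) (carrier (Zp p))"
    and falling_zero: "\<lbrakk>p \<le> n; b \<in> carrier B\<rbrakk> \<Longrightarrow> falling B n b = \<zero>\<^bsub>B\<^esub>"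

text \<open>Only meaningful for \<open>n < p\<close>, where \<open>n!\<close> is invertible in \<open>\<int>\<^sub>p\<close>; for \<open>n = 0\<close> the
  empty product gives 1.\<close>

definition zeta :: "nat \<Rightarrow> (int, 'b, 'm) module_scheme \<Rightarrow> nat \<Rightarrow> 'b \<Rightarrow> 'b" where
  "zeta p B n b = (inv\<^bsub>Zp p\<^esub> ([(fact n :: nat)] \<cdot>\<^bsub>Zp p\<^esub> \<one>\<^bsub>Zp p\<^esub>)) \<odot>\<^bsub>B\<^esub> falling B n b"

text \<open>Multi-indices \<open>(i\<^sub>1, \<dots>, i\<^sub>n)\<close> and tuples \<open>(b\<^sub>1, \<dots>, b\<^sub>n)\<close> are functions on \<open>{1..n}\<close>.\<close>

definition zeta_multi ::
  "nat \<Rightarrow> (int, 'b, 'm) module_scheme \<Rightarrow> nat \<Rightarrow> (nat \<Rightarrow> nat) \<Rightarrow> (nat \<Rightarrow> 'b) \<Rightarrow> 'b" where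
  "zeta_multi p B n I b = (\<Otimes>\<^bsub>B\<^esub>j\<in>{1..n}. zeta p B (I j) (b j))"

locale binomial_cup1_dga =
  dg_algebra "Zp p" A G d + cup_one_algebra "Zp p" A G cup1
  for p :: nat and A :: "(int, 'a, 'm) module_scheme" (structure) and G d cup1 +
  assumes ex_circ:
      "\<exists>circ. bilinear_on (Zp p) A (decomposables2 (Zp p) A G) (decomposables2 (Zp p) A G)
                (decomposables2 (Zp p) A G) circ \<and>
         (\<forall>u\<in>G 1. \<forall>v\<in>G 1. \<forall>w\<in>G 1. \<forall>z\<in>G 1.
            circ (u \<otimes>\<^bsub>A\<^esub> v) (w \<otimes>\<^bsub>A\<^esub> z) = cup1 u w \<otimes>\<^bsub>A\<^esub> cup1 v z) \<and>
         (\<forall>a\<in>G 1. \<forall>b\<in>G 1.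
            d a \<in> decomposables2 (Zp p) A G \<longrightarrow> d b \<in> decomposables2 (Zp p) A G \<longrightarrow>
            d (cup1 a b) =
              (\<ominus>\<^bsub>A\<^esub> (a \<otimes>\<^bsub>A\<^esub> b)) \<ominus>\<^bsub>A\<^esub> b \<otimes>\<^bsub>A\<^esub> a \<oplus>\<^bsub>A\<^esub> cup1 (d a) b \<oplus>\<^bsub>A\<^esub> cup1 (d b) a
                \<ominus>\<^bsub>A\<^esub> circ (d a) (d b))"
    and cup_one_binomial: "Zp_binomial_algebra p (cup_one_ring (Zp p) A G cup1)"

definition Z1 :: "('r, 'a, 'm) module_scheme \<Rightarrow> (nat \<Rightarrow> 'a set) \<Rightarrow> ('a \<Rightarrow> 'a) \<Rightarrow> 'a set" where
  "Z1 A G d = {a \<in> G 1. d a = \<zero>\<^bsub>A\<^esub>}"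

text \<open>The inclusion \<open>R \<oplus> A\<^sup>1 \<subseteq> A\<^sup>0 \<oplus> A\<^sup>1 \<subseteq> A\<close> given by the structure map \<open>R \<rightarrow> A\<^sup>0\<close>.\<close>

definition to_dga :: "('r, 'a, 'm) module_scheme \<Rightarrow> 'r \<times> 'a \<Rightarrow> 'a" where
  "to_dga A = (\<lambda>(r, a). r \<odot>\<^bsub>A\<^esub> \<one>\<^bsub>A\<^esub> \<oplus>\<^bsub>A\<^esub> a)"

text \<open>\<open>\<zeta>\<^sub>k(a)\<close> and \<open>\<zeta>\<^sub>I(a)\<close> for (tuples of) elements of \<open>A\<^sup>1\<close>, computed in \<open>\<int>\<^sub>p \<oplus> A\<^sup>1\<close> and
  regarded as elements of \<open>A\<close>.\<close>

definition zeta_dga ::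
  "nat \<Rightarrow> (int, 'a, 'm) module_scheme \<Rightarrow> (nat \<Rightarrow> 'a set) \<Rightarrow> ('a \<Rightarrow> 'a \<Rightarrow> 'a) \<Rightarrow>
   nat \<Rightarrow> 'a \<Rightarrow> 'a" where
  "zeta_dga p A G cup1 k a =
     to_dga A (zeta p (cup_one_ring (Zp p) A G cup1) k (\<zero>\<^bsub>Zp p\<^esub>, a))"

definition zeta_multi_dga ::
  "nat \<Rightarrow> (int, 'a, 'm) module_scheme \<Rightarrow> (nat \<Rightarrow> 'a set) \<Rightarrow> ('a \<Rightarrow> 'a \<Rightarrow> 'a) \<Rightarrow>
   nat \<Rightarrow> (nat \<Rightarrow> nat) \<Rightarrow> (nat \<Rightarrow> 'a) \<Rightarrow> 'a" where
  "zeta_multi_dga p A G cup1 n I a =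
     to_dga A (zeta_multi p (cup_one_ring (Zp p) A G cup1) n I (\<lambda>j. (\<zero>\<^bsub>Zp p\<^esub>, a j)))"

text \<open>Ordered pairs of non-zero \<open>n\<close>-tuples of non-negative integers with sum \<open>I\<close>. Extensional
  functions (\<open>\<rightarrow>\<^sub>E\<close>) make each tuple occur once.\<close>

definition splittings :: "nat \<Rightarrow> (nat \<Rightarrow> nat) \<Rightarrow> ((nat \<Rightarrow> nat) \<times> (nat \<Rightarrow> nat)) set" where
  "splittings n I =
     {(I1, I2). I1 \<in> {1..n} \<rightarrow>\<^sub>E UNIV \<and> I2 \<in> {1..n} \<rightarrow>\<^sub>E UNIV \<and>
        (\<forall>j\<in>{1..n}. I1 j + I2 j = I j) \<and>
        (\<exists>j\<in>{1..n}. I1 j \<noteq> 0) \<and> (\<exists>j\<in>{1..n}. I2 j \<noteq> 0)}"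

end

theory Submission
  imports Defs
begin

text \<open>Let \<open>B = \<int>\<^sub>p \<oplus> A\<^sup>1\<close> with the cup-one multiplication. The formula for \<open>d(a \<union>\<^sub>1 b)\<close>, the Hirsch
  identity and the map \<open>\<circ>\<close> say together that \<open>b \<mapsto> 1 \<otimes> b + b \<otimes> 1 - db\<close> behaves like a coproduct: it is
  multiplicative on the elements of \<open>A\<^sup>1\<close> with decomposable differential. A cocycle \<open>a\<close> is primitive
  for it, and therefore \<open>\<zeta>\<^sub>k(a)\<close>, being a binomial coefficient in \<open>a\<close>, satisfies the
  Vandermonde identity and is sent to \<open>\<Sum>\<^sub>l \<zeta>\<^sub>l(a) \<otimes> \<zeta>\<^sub>k\<^sub>-\<^sub>l(a)\<close>. Multiplying such coproducts gives
  \<open>\<Sum>\<^sub>J \<zeta>\<^sub>J \<otimes> \<zeta>\<^sub>I\<^sub>-\<^sub>J\<close> for \<open>\<zeta>\<^sub>I\<close>. Comparing components in \<open>A\<^sup>2\<close>, where the terms with a factor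
  \<open>\<zeta>\<^sub>0 = 1\<close> drop out, gives the claim.

  The tensor product is replaced by finite families of pairs of elements of \<open>B\<close> (definition
  \<open>coproduct_family\<close>), subject to the counit equations and to the equation for the differential. The
  argument rests on three facts: coproduct families multiply (\<open>coproduct_family_mult\<close>), the pairs
  \<open>(\<zeta>\<^sub>l(a), \<zeta>\<^sub>k\<^sub>-\<^sub>l(a))\<close> form a coproduct family for \<open>\<zeta>\<^sub>k(a)\<close> (\<open>coproduct_family_zeta\<close>), and the pairs
  \<open>(\<zeta>\<^sub>J, \<zeta>\<^sub>I\<^sub>-\<^sub>J)\<close> form one for \<open>\<zeta>\<^sub>I\<close> (\<open>coproduct_family_zeta_multi\<close>).\<close>

section \<open>Additive maps and finite sums\<close>

lemma (in comm_monoid) finprod_cartesian_product: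
  assumes "finite S" "finite T" "\<And>i j. \<lbrakk>i \<in> S; j \<in> T\<rbrakk> \<Longrightarrow> f i j \<in> carrier G"
  shows "(\<Otimes>z\<in>S \<times> T. f (fst z) (snd z)) = (\<Otimes>i\<in>S. \<Otimes>j\<in>T. f i j)"
proof -
  have "(\<Otimes>z\<in>(\<Union>i\<in>S. Pair i ` T). f (fst z) (snd z))
      = (\<Otimes>i\<in>S. \<Otimes>z\<in>Pair i ` T. f (fst z) (snd z))"
    using assms by (intro finprod_UN_disjoint) (auto simp: pairwise_def disjnt_def)
  also have "(\<Union>i\<in>S. Pair i ` T) = S \<times> T"
    by auto
  also have "(\<Otimes>i\<in>S. \<Otimes>z\<in>Pair i ` T. f (fst z) (snd z)) = (\<Otimes>i\<in>S. \<Otimes>j\<in>T. f i j)"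
  proof (rule finprod_cong'[OF refl])
    show "(\<Otimes>z\<in>Pair i ` T. f (fst z) (snd z)) = (\<Otimes>j\<in>T. f i j)" if "i \<in> S" for i
      using assms that by (subst finprod_reindex) (auto simp: inj_on_def)
  qed (use assms in \<open>auto intro!: finprod_closed\<close>)
  finally show ?thesis .
qed

lemma (in comm_monoid) finprod_cartesian_product_swap:
  assumes "finite S" "finite T" "\<And>i j. \<lbrakk>i \<in> S; j \<in> T\<rbrakk> \<Longrightarrow> f i j \<in> carrier G"
  shows "(\<Otimes>z\<in>S \<times> T. f (fst z) (snd z)) = (\<Otimes>j\<in>T. \<Otimes>i\<in>S. f i j)"
proof -
  have "(\<Otimes>z\<in>prod.swap ` (T \<times> S). f (fst z) (snd z)) = (\<Otimes>z\<in>T \<times> S. f (snd z) (fst z))"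
    using assms by (subst finprod_reindex) (auto simp: inj_on_def)
  also have "\<dots> = (\<Otimes>j\<in>T. \<Otimes>i\<in>S. f i j)"
    using assms by (intro finprod_cartesian_product[where f = "\<lambda>j i. f i j"]) auto
  finally show ?thesis
    by (simp add: product_swap)
qed

lemmas (in abelian_monoid) finsum_cartesian_product = add.finprod_cartesian_product
lemmas (in abelian_monoid) finsum_cartesian_product_swap = add.finprod_cartesian_product_swap

text \<open>A subset closed under finite sums. The degree parts \<open>A\<^sup>1\<close>, \<open>A\<^sup>2\<close> and the module \<open>D\<^sup>2(A)\<close> are
  the domains on which the cup-one products and the map \<open>\<circ>\<close> are additive.\<close>

definition add_closed :: "('a, 'm) ring_scheme \<Rightarrow> 'a set \<Rightarrow> bool" where
  "add_closed M U \<longleftrightarrow> U \<subseteq> carrier M \<and> \<zero>\<^bsub>M\<^esub> \<in> U \<and> (\<forall>u\<in>U. \<forall>v\<in>U. u \<oplus>\<^bsub>M\<^esub> v \<in> U)"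

lemma (in abelian_monoid) add_closed_carrier: "add_closed G (carrier G)"
  by (auto simp: add_closed_def)

lemma (in module) submodule_add_closed: "submodule H R M \<Longrightarrow> add_closed M H"
  using submoduleE[of H] subgroup.one_closed[OF submodule.axioms(1), of H R M]
  by (simp add: add_closed_def)

lemma (in abelian_monoid) finsum_in_add_closed:
  assumes "add_closed G U" "\<And>i. i \<in> S \<Longrightarrow> x i \<in> U"
  shows "finsum G x S \<in> U"
  using assms(2)
proof (induction S rule: infinite_finite_induct)
  case (insert i S)
  then have "x \<in> S \<rightarrow> carrier G" "x i \<in> carrier G"
    using assms(1) by (auto simp: add_closed_def)
  then show ?case
    using insert assms(1) by (simp add: add_closed_def)
qed (use assms(1) in \<open>auto simp: add_closed_def\<close>)

text \<open>The abelian groups \<open>M\<close> and \<open>N\<close> may have different types, so that the lemma also covers the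
  projections of \<open>\<int>\<^sub>p \<oplus> A\<^sup>1\<close> to \<open>\<int>\<^sub>p\<close> and to \<open>A\<^sup>1\<close>. For infinite \<open>S\<close> both sums are 0 by convention.\<close>

lemma additive_finsum:
  assumes "abelian_group M" "abelian_group N" and U: "add_closed M U"
    and f: "\<And>u. u \<in> U \<Longrightarrow> f u \<in> carrier N"
    and add: "\<And>u v. \<lbrakk>u \<in> U; v \<in> U\<rbrakk> \<Longrightarrow> f (u \<oplus>\<^bsub>M\<^esub> v) = f u \<oplus>\<^bsub>N\<^esub> f v"
    and x: "\<And>i. i \<in> S \<Longrightarrow> x i \<in> U"
  shows "f (finsum M x S) = (\<Oplus>\<^bsub>N\<^esub>i\<in>S. f (x i))"
proof -
  interpret M: abelian_group M by fact
  interpret N: abelian_group N by fact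
  have z: "\<zero>\<^bsub>M\<^esub> \<in> U" and sub: "U \<subseteq> carrier M"
    using U by (auto simp: add_closed_def)
  have f0: "f \<zero>\<^bsub>M\<^esub> = \<zero>\<^bsub>N\<^esub>"
    using add[OF z z] f[OF z] by (simp add: N.add.r_cancel_one)
  show ?thesis
    using x
  proof (induction S rule: infinite_finite_induct)
    case (insert i S)
    have "finsum M x S \<in> U"
      using insert.prems by (intro M.finsum_in_add_closed[OF U]) auto
    moreover have "x \<in> S \<rightarrow> carrier M" "x i \<in> carrier M" "x i \<in> U"
      using insert.prems sub by auto
    moreover have "(\<lambda>i. f (x i)) \<in> S \<rightarrow> carrier N" "f (x i) \<in> carrier N"
      using insert.prems f by auto
    ultimately show ?case
      using insert add by simp
  qed (simp_all add: f0)
qed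

lemma biadditive_finsum:
  assumes "abelian_group M" "abelian_group M'" "abelian_group N"
    and U: "add_closed M U" and V: "add_closed M' V"
    and f: "\<And>u v. \<lbrakk>u \<in> U; v \<in> V\<rbrakk> \<Longrightarrow> f u v \<in> carrier N"
    and addl: "\<And>u u' v. \<lbrakk>u \<in> U; u' \<in> U; v \<in> V\<rbrakk> \<Longrightarrow> f (u \<oplus>\<^bsub>M\<^esub> u') v = f u v \<oplus>\<^bsub>N\<^esub> f u' v"
    and addr: "\<And>u v v'. \<lbrakk>u \<in> U; v \<in> V; v' \<in> V\<rbrakk> \<Longrightarrow> f u (v \<oplus>\<^bsub>M'\<^esub> v') = f u v \<oplus>\<^bsub>N\<^esub> f u v'"
    and fin: "finite S" "finite T"
    and x: "\<And>i. i \<in> S \<Longrightarrow> x i \<in> U" and y: "\<And>j. j \<in> T \<Longrightarrow> y j \<in> V"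
  shows "(\<Oplus>\<^bsub>N\<^esub>z\<in>S \<times> T. f (x (fst z)) (y (snd z))) = f (finsum M x S) (finsum M' y T)"
proof -
  interpret M': abelian_group M' by fact
  interpret N: abelian_group N by fact
  have yV: "finsum M' y T \<in> V"
    by (rule M'.finsum_in_add_closed[OF V y])
  have "(\<Oplus>\<^bsub>N\<^esub>z\<in>S \<times> T. f (x (fst z)) (y (snd z))) = (\<Oplus>\<^bsub>N\<^esub>i\<in>S. \<Oplus>\<^bsub>N\<^esub>j\<in>T. f (x i) (y j))"
    using fin x y f by (intro N.finsum_cartesian_product[where f = "\<lambda>i j. f (x i) (y j)"]) auto
  also have "\<dots> = (\<Oplus>\<^bsub>N\<^esub>i\<in>S. f (x i) (finsum M' y T))"
  proof (rule N.finsum_cong'[OF refl])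
    show "(\<Oplus>\<^bsub>N\<^esub>j\<in>T. f (x i) (y j)) = f (x i) (finsum M' y T)" if "i \<in> S" for i
      using that x y f addr
      by (intro additive_finsum[OF assms(2,3) V, where f = "f (x i)", symmetric]) auto
  qed (use x f yV in auto)
  also have "\<dots> = f (finsum M x S) (finsum M' y T)"
    using x yV f addl
    by (intro additive_finsum[OF assms(1,3) U, where f = "\<lambda>u. f u (finsum M' y T)", symmetric]) auto
  finally show ?thesis .
qed

section \<open>Submodules and bilinear maps\<close>

lemma (in module) decomposables2_submodule:
  assumes "\<And>a b. \<lbrakk>a \<in> G 1; b \<in> G 1\<rbrakk> \<Longrightarrow> a \<otimes>\<^bsub>M\<^esub> b \<in> carrier M"
  shows "submodule (decomposables2 R M G) R M"
proof (rule submoduleI)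
  have "submodule (carrier M) R M"
    by (rule carrier_is_submodule)
  then show "decomposables2 R M G \<subseteq> carrier M"
    using assms unfolding decomposables2_def by blast
  show "\<zero>\<^bsub>M\<^esub> \<in> decomposables2 R M G"
    using subgroup.one_closed[OF submodule.axioms(1)] by (force simp: decomposables2_def)
qed (auto simp: decomposables2_def intro: submoduleE)

lemma (in module) bilinear_on_minus:
  assumes "bilinear_on R M U V W f" "U \<subseteq> carrier M" "V \<subseteq> carrier M" "W \<subseteq> carrier M"
    and "u \<in> U" "v \<in> V"
  shows "f (\<ominus>\<^bsub>M\<^esub> u) v = \<ominus>\<^bsub>M\<^esub> f u v" "f u (\<ominus>\<^bsub>M\<^esub> v) = \<ominus>\<^bsub>M\<^esub> f u v"
proof -
  have neg: "\<ominus>\<^bsub>M\<^esub> x = (\<ominus> \<one>) \<odot>\<^bsub>M\<^esub> x" if "x \<in> carrier M" for x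
    using that smult_l_minus[of \<one> x] by simp
  have "f u v \<in> carrier M" "u \<in> carrier M" "v \<in> carrier M"
    using assms by (auto simp: bilinear_on_def)
  then show "f (\<ominus>\<^bsub>M\<^esub> u) v = \<ominus>\<^bsub>M\<^esub> f u v" "f u (\<ominus>\<^bsub>M\<^esub> v) = \<ominus>\<^bsub>M\<^esub> f u v"
    using assms by (simp_all add: neg bilinear_on_def)
qed

section \<open>The ring of degree one elements and the cup-one products\<close>

text \<open>Keeps \<open>A\<^sup>1\<close> written as \<open>G 1\<close> during simplification.\<close>

declare One_nat_def [simp del]

context binomial_cup1_dga
begin

text \<open>The ring \<open>B = \<int>\<^sub>p \<oplus> A\<^sup>1\<close>. Its first projection \<open>fst\<close> is the augmentation, a ring homomorphism
  to \<open>\<int>\<^sub>p\<close>; \<open>snd\<close> is the component in \<open>A\<^sup>1\<close>.\<close>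

abbreviation B :: "(int, int \<times> 'a) module" where
  "B \<equiv> cup_one_ring (Zp p) A G cup1"

interpretation B: Zp_binomial_algebra p B
  by (rule cup_one_binomial)

lemma B_sel:
  "carrier B = carrier (Zp p) \<times> G 1"
  "\<one>\<^bsub>B\<^esub> = (\<one>\<^bsub>Zp p\<^esub>, \<zero>)"
  "\<zero>\<^bsub>B\<^esub> = (\<zero>\<^bsub>Zp p\<^esub>, \<zero>)"
  "fst (x \<oplus>\<^bsub>B\<^esub> y) = fst x \<oplus>\<^bsub>Zp p\<^esub> fst y"
  "snd (x \<oplus>\<^bsub>B\<^esub> y) = snd x \<oplus> snd y"
  "fst (x \<otimes>\<^bsub>B\<^esub> y) = fst x \<otimes>\<^bsub>Zp p\<^esub> fst y"
  "snd (x \<otimes>\<^bsub>B\<^esub> y) = fst x \<odot> snd y \<oplus> fst y \<odot> snd x \<oplus> cup1 (snd x) (snd y)"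
  "fst (r \<odot>\<^bsub>B\<^esub> x) = r \<otimes>\<^bsub>Zp p\<^esub> fst x"
  "snd (r \<odot>\<^bsub>B\<^esub> x) = r \<odot> snd x"
  by (simp_all add: cup_one_ring_def split_beta)

lemma fst_snd_B:
  assumes "x \<in> carrier B"
  shows "fst x \<in> carrier (Zp p)" "snd x \<in> G 1"
  using assms by (auto simp: B_sel)

lemma G_subset: "G i \<subseteq> carrier A"
  by (rule submoduleE(1)[OF graded_submodule])

lemma G_carrier [simp]: "x \<in> G i \<Longrightarrow> x \<in> carrier A"
  using G_subset by blast

lemma G_closed [simp]:
  "\<zero> \<in> G i"
  "x \<in> G i \<Longrightarrow> y \<in> G i \<Longrightarrow> x \<oplus> y \<in> G i"
  "x \<in> G i \<Longrightarrow> \<ominus> x \<in> G i"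
  "r \<in> carrier (Zp p) \<Longrightarrow> x \<in> G i \<Longrightarrow> r \<odot> x \<in> G i"
  using submoduleE[OF graded_submodule[of i]]
    subgroup.one_closed[OF submodule.axioms(1)[OF graded_submodule[of i]]]
  by simp_all

lemma cup_G2 [simp]: "x \<in> G 1 \<Longrightarrow> y \<in> G 1 \<Longrightarrow> x \<otimes> y \<in> G 2"
  using graded_mult[of x 1 y 1] by (simp add: numeral_2_eq_2)

lemma d_G2 [simp]: "x \<in> G 1 \<Longrightarrow> d x \<in> G 2"
  using d_degree[of x 1] by (simp add: numeral_2_eq_2)

lemma cup1_simps:
  assumes "i = 1 \<or> i = 2" "x \<in> G i" "y \<in> G 1"
  shows "cup1 x y \<in> G i"
    "x' \<in> G i \<Longrightarrow> cup1 (x \<oplus> x') y = cup1 x y \<oplus> cup1 x' y"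
    "y' \<in> G 1 \<Longrightarrow> cup1 x (y \<oplus> y') = cup1 x y \<oplus> cup1 x y'"
    "r \<in> carrier (Zp p) \<Longrightarrow> cup1 (r \<odot> x) y = r \<odot> cup1 x y"
    "r \<in> carrier (Zp p) \<Longrightarrow> cup1 x (r \<odot> y) = r \<odot> cup1 x y"
    "cup1 (\<ominus> x) y = \<ominus> cup1 x y"
  using assms cup1_bilinear[of i] bilinear_on_minus(1)[OF cup1_bilinear[of i]]
  by (auto simp: bilinear_on_def G_subset)

lemmas cup1_1 [simp] = cup1_simps[of 1, simplified] and cup1_2 [simp] = cup1_simps[of 2, simplified]

lemma cup1_commute:
  assumes "x \<in> G 1" "y \<in> G 1"
  shows "cup1 x y = cup1 y x"
proof -
  have "(\<zero>\<^bsub>Zp p\<^esub>, x) \<in> carrier B" "(\<zero>\<^bsub>Zp p\<^esub>, y) \<in> carrier B"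
    using assms by (simp_all add: B_sel)
  then have "snd ((\<zero>\<^bsub>Zp p\<^esub>, x) \<otimes>\<^bsub>B\<^esub> (\<zero>\<^bsub>Zp p\<^esub>, y)) = snd ((\<zero>\<^bsub>Zp p\<^esub>, y) \<otimes>\<^bsub>B\<^esub> (\<zero>\<^bsub>Zp p\<^esub>, x))"
    by (simp add: B.m_comm)
  then show ?thesis
    using assms unfolding B_sel by (simp add: G_carrier[of _ 1])
qed

text \<open>The cup product of the \<open>A\<^sup>1\<close>-components of two products in \<open>B\<close>. The nine terms are grouped by the
  structure that will evaluate their sums over coproduct families: bilinearity for the first two
  lines, the Hirsch identity for the third and fourth, and the map \<open>\<circ>\<close> for the last.\<close>

lemma cup_of_products:
  assumes "r \<in> carrier (Zp p)" "r' \<in> carrier (Zp p)" "s \<in> carrier (Zp p)" "s' \<in> carrier (Zp p)"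
    and "u \<in> G 1" "u' \<in> G 1" "v \<in> G 1" "v' \<in> G 1"
  shows "(r \<odot> u' \<oplus> r' \<odot> u \<oplus> cup1 u u') \<otimes> (s \<odot> v' \<oplus> s' \<odot> v \<oplus> cup1 v v') =
      ((r \<otimes>\<^bsub>Zp p\<^esub> s) \<odot> (u' \<otimes> v') \<oplus> (r' \<otimes>\<^bsub>Zp p\<^esub> s') \<odot> (u \<otimes> v))
    \<oplus> ((s' \<odot> u') \<otimes> (r \<odot> v) \<oplus> (s \<odot> u) \<otimes> (r' \<odot> v'))
    \<oplus> (u' \<otimes> cup1 (r \<odot> v) v' \<oplus> cup1 (s \<odot> u) u' \<otimes> v')
    \<oplus> (u \<otimes> cup1 (r' \<odot> v') v \<oplus> cup1 (s' \<odot> u') u \<otimes> v)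
    \<oplus> cup1 u u' \<otimes> cup1 v v'"
proof -
  note G1 = G_carrier[of _ 1]
  have [simp]: "cup1 u u' \<in> carrier A" "cup1 v v' \<in> carrier A"
    using assms by (simp_all add: G1)
  have [simp]: "r' \<odot> (s \<odot> x) = s \<odot> (r' \<odot> x)" "r \<odot> (s' \<odot> x) = s' \<odot> (r \<odot> x)"
    "r \<odot> (s \<odot> x) = s \<odot> (r \<odot> x)" "r' \<odot> (s' \<odot> x) = s' \<odot> (r' \<odot> x)"
    if "x \<in> carrier A" for x
    using assms that by (simp_all add: smult_assoc1[symmetric] R.m_comm)
  have [simp]: "cup1 u' u = cup1 u u'" "cup1 v' v = cup1 v v'"
    using assms by (simp_all add: cup1_commute)
  show ?thesis
    using assms
    by (simp add: G1 l_distr r_distr smult_mult_left smult_mult_right smult_assoc1 a_ac smult_r_distr)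
qed

section \<open>Coproduct families\<close>

text \<open>A finite family of pairs \<open>(x\<^sub>i, y\<^sub>i)\<close> of elements of \<open>B\<close> represents the element
  \<open>\<Sum> x\<^sub>i \<otimes> y\<^sub>i\<close> of \<open>B \<otimes> B\<close>. It is called a coproduct family for \<open>b\<close> if it satisfies the two counit
  equations and if the cup product sends it, after projection to \<open>A\<^sup>1\<close> in both factors, to \<open>-d\<close> of
  the \<open>A\<^sup>1\<close>-component of \<open>b\<close>. The three sums depend on the family only through
  \<open>\<Sum> x\<^sub>i \<otimes> y\<^sub>i\<close>, so that no tensor product has to be constructed.\<close>

definition coproduct_family ::
  "'i set \<Rightarrow> ('i \<Rightarrow> int \<times> 'a) \<Rightarrow> ('i \<Rightarrow> int \<times> 'a) \<Rightarrow> int \<times> 'a \<Rightarrow> bool" where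
  "coproduct_family S x y b \<longleftrightarrow>
     finite S \<and> (\<forall>i\<in>S. x i \<in> carrier B \<and> y i \<in> carrier B) \<and> b \<in> carrier B \<and>
     (\<Oplus>\<^bsub>B\<^esub>i\<in>S. fst (x i) \<odot>\<^bsub>B\<^esub> y i) = b \<and>
     (\<Oplus>\<^bsub>B\<^esub>i\<in>S. fst (y i) \<odot>\<^bsub>B\<^esub> x i) = b \<and>
     (\<Oplus>i\<in>S. snd (x i) \<otimes> snd (y i)) = \<ominus> d (snd b)"

lemma B_smult_mult_right:
  assumes "r \<in> carrier (Zp p)" "x \<in> carrier B" "y \<in> carrier B"
  shows "x \<otimes>\<^bsub>B\<^esub> (r \<odot>\<^bsub>B\<^esub> y) = r \<odot>\<^bsub>B\<^esub> (x \<otimes>\<^bsub>B\<^esub> y)"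
  using assms B.smult_assoc2[of r y x] by (simp add: B.m_comm)

text \<open>The counit equations are multiplicative because \<open>fst\<close> is a ring homomorphism.\<close>

lemma counit_mult:
  assumes "finite S" "finite T"
    and "\<And>i. i \<in> S \<Longrightarrow> x i \<in> carrier B" "\<And>i. i \<in> S \<Longrightarrow> y i \<in> carrier B"
    and "\<And>j. j \<in> T \<Longrightarrow> x' j \<in> carrier B" "\<And>j. j \<in> T \<Longrightarrow> y' j \<in> carrier B"
  shows "(\<Oplus>\<^bsub>B\<^esub>z\<in>S \<times> T. fst (x (fst z) \<otimes>\<^bsub>B\<^esub> x' (snd z)) \<odot>\<^bsub>B\<^esub> (y (fst z) \<otimes>\<^bsub>B\<^esub> y' (snd z))) =
    (\<Oplus>\<^bsub>B\<^esub>i\<in>S. fst (x i) \<odot>\<^bsub>B\<^esub> y i) \<otimes>\<^bsub>B\<^esub> (\<Oplus>\<^bsub>B\<^esub>j\<in>T. fst (x' j) \<odot>\<^bsub>B\<^esub> y' j)"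
proof -
  have "(\<Oplus>\<^bsub>B\<^esub>z\<in>S \<times> T. fst (x (fst z) \<otimes>\<^bsub>B\<^esub> x' (snd z)) \<odot>\<^bsub>B\<^esub> (y (fst z) \<otimes>\<^bsub>B\<^esub> y' (snd z))) =
    (\<Oplus>\<^bsub>B\<^esub>z\<in>S \<times> T. (fst (x (fst z)) \<odot>\<^bsub>B\<^esub> y (fst z)) \<otimes>\<^bsub>B\<^esub> (fst (x' (snd z)) \<odot>\<^bsub>B\<^esub> y' (snd z)))"
  proof (rule B.finsum_cong'[OF refl])
    fix z assume "z \<in> S \<times> T"
    then have c: "x (fst z) \<in> carrier B" "y (fst z) \<in> carrier B"
      "x' (snd z) \<in> carrier B" "y' (snd z) \<in> carrier B"
      using assms by auto
    note f = fst_snd_B(1)[OF c(1)] fst_snd_B(1)[OF c(3)]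
    show "fst (x (fst z) \<otimes>\<^bsub>B\<^esub> x' (snd z)) \<odot>\<^bsub>B\<^esub> (y (fst z) \<otimes>\<^bsub>B\<^esub> y' (snd z)) =
      (fst (x (fst z)) \<odot>\<^bsub>B\<^esub> y (fst z)) \<otimes>\<^bsub>B\<^esub> (fst (x' (snd z)) \<odot>\<^bsub>B\<^esub> y' (snd z))"
      using c f
      by (simp add: B_sel(6) B.smult_assoc2 B_smult_mult_right B.smult_assoc1[symmetric] R.m_comm)
  qed (use assms in \<open>auto intro!: B.m_closed B.smult_closed fst_snd_B(1)\<close>)
  also have "\<dots> = (\<Oplus>\<^bsub>B\<^esub>i\<in>S. fst (x i) \<odot>\<^bsub>B\<^esub> y i) \<otimes>\<^bsub>B\<^esub> (\<Oplus>\<^bsub>B\<^esub>j\<in>T. fst (x' j) \<odot>\<^bsub>B\<^esub> y' j)"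
    using assms fst_snd_B
    by (intro biadditive_finsum[OF B.abelian_group_axioms B.abelian_group_axioms
          B.abelian_group_axioms B.add_closed_carrier B.add_closed_carrier, where f = "monoid.mult B"])
      (auto simp: B.l_distr B.r_distr)
  finally show ?thesis .
qed

lemma B_finsum_sel:
  assumes "\<And>i. i \<in> S \<Longrightarrow> f i \<in> carrier B"
  shows "fst (finsum B f S) = (\<Oplus>\<^bsub>Zp p\<^esub>i\<in>S. fst (f i))"
    and "snd (finsum B f S) = (\<Oplus>i\<in>S. snd (f i))"
  by (rule additive_finsum[OF B.abelian_group_axioms R.abelian_group_axioms B.add_closed_carrier],
      use assms fst_snd_B in \<open>auto simp: B_sel(4)\<close>)
    (rule additive_finsum[OF B.abelian_group_axioms abelian_group_axioms B.add_closed_carrier],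
      use assms fst_snd_B in \<open>auto simp: B_sel(5) G_carrier[of _ 1]\<close>)

text \<open>The defining equations in components.\<close>

lemma coproduct_family_sums:
  assumes "coproduct_family S x y b"
  shows "(\<Oplus>\<^bsub>Zp p\<^esub>i\<in>S. fst (x i) \<otimes>\<^bsub>Zp p\<^esub> fst (y i)) = fst b"
    and "(\<Oplus>i\<in>S. fst (x i) \<odot> snd (y i)) = snd b"
    and "(\<Oplus>i\<in>S. fst (y i) \<odot> snd (x i)) = snd b"
    and "(\<Oplus>i\<in>S. snd (x i) \<otimes> snd (y i)) = \<ominus> d (snd b)"
proof -
  have c: "x i \<in> carrier B" "y i \<in> carrier B" if "i \<in> S" for i
    using assms that by (auto simp: coproduct_family_def)
  have "(\<Oplus>\<^bsub>B\<^esub>i\<in>S. fst (x i) \<odot>\<^bsub>B\<^esub> y i) = b" "(\<Oplus>\<^bsub>B\<^esub>i\<in>S. fst (y i) \<odot>\<^bsub>B\<^esub> x i) = b"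
    using assms by (auto simp: coproduct_family_def)
  then show "(\<Oplus>\<^bsub>Zp p\<^esub>i\<in>S. fst (x i) \<otimes>\<^bsub>Zp p\<^esub> fst (y i)) = fst b"
    and "(\<Oplus>i\<in>S. fst (x i) \<odot> snd (y i)) = snd b"
    and "(\<Oplus>i\<in>S. fst (y i) \<odot> snd (x i)) = snd b"
    using B_finsum_sel[of S "\<lambda>i. fst (x i) \<odot>\<^bsub>B\<^esub> y i"] B_finsum_sel[of S "\<lambda>i. fst (y i) \<odot>\<^bsub>B\<^esub> x i"]
      c fst_snd_B(1) by (auto simp: B_sel(8,9))
qed (use assms in \<open>simp add: coproduct_family_def\<close>)

text \<open>The module \<open>D\<^sup>2(A)\<close>.\<close>

abbreviation D2 :: "'a set" where
  "D2 \<equiv> decomposables2 (Zp p) A G"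

lemma D2_submodule: "submodule D2 (Zp p) A"
  by (rule decomposables2_submodule) (simp add: G_carrier[of _ 1])

lemma cup_in_D2: "u \<in> G 1 \<Longrightarrow> v \<in> G 1 \<Longrightarrow> u \<otimes> v \<in> D2"
  by (auto simp: decomposables2_def)

text \<open>The Hirsch identity needs the same second argument \<open>w\<close> in both summands. The two families
  \<open>x\<close> and \<open>y\<close> differ termwise, but both sum to \<open>w\<close>; for a coproduct family this is what the two
  counit equations provide.\<close>

lemma Hirsch_sum:
  assumes u: "u \<in> G 1" "v \<in> G 1" and xy: "\<And>i. i \<in> S \<Longrightarrow> x i \<in> G 1" "\<And>i. i \<in> S \<Longrightarrow> y i \<in> G 1"
    and w: "finsum A x S = w" "finsum A y S = w"
  shows "(\<Oplus>i\<in>S. u \<otimes> cup1 (x i) v \<oplus> cup1 (y i) u \<otimes> v) = cup1 (u \<otimes> v) w"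
proof -
  note [simp] = G_carrier[of _ 1] G_carrier[of _ 2]
  have G1: "add_closed A (G 1)"
    by (rule submodule_add_closed[OF graded_submodule])
  have "w \<in> G 1"
    using finsum_in_add_closed[OF G1, of S x] xy(1) w(1) by simp
  then have "cup1 (u \<otimes> v) w = u \<otimes> cup1 (finsum A x S) v \<oplus> cup1 (finsum A y S) u \<otimes> v"
    using u by (simp add: cup1_Hirsch cup1_commute w)
  also have "u \<otimes> cup1 (finsum A x S) v = (\<Oplus>i\<in>S. u \<otimes> cup1 (x i) v)"
    using u xy by (intro additive_finsum[OF abelian_group_axioms abelian_group_axioms G1,
          where f = "\<lambda>t. u \<otimes> cup1 t v"]) (auto simp: r_distr)
  also have "cup1 (finsum A y S) u \<otimes> v = (\<Oplus>i\<in>S. cup1 (y i) u \<otimes> v)"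
    using u xy by (intro additive_finsum[OF abelian_group_axioms abelian_group_axioms G1,
          where f = "\<lambda>t. cup1 t u \<otimes> v"]) (auto simp: l_distr)
  also have "(\<Oplus>i\<in>S. u \<otimes> cup1 (x i) v) \<oplus> (\<Oplus>i\<in>S. cup1 (y i) u \<otimes> v)
      = (\<Oplus>i\<in>S. u \<otimes> cup1 (x i) v \<oplus> cup1 (y i) u \<otimes> v)"
    using u xy by (intro finsum_addf[symmetric]) auto
  finally show ?thesis by simp
qed

lemma cup1_finsum:
  assumes "\<And>i. i \<in> S \<Longrightarrow> x i \<in> G 2" "w \<in> G 1"
  shows "(\<Oplus>i\<in>S. cup1 (x i) w) = cup1 (finsum A x S) w"
  using assms
  by (intro additive_finsum[OF abelian_group_axioms abelian_group_axioms
        submodule_add_closed[OF graded_submodule], where f = "\<lambda>t. cup1 t w", symmetric])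
    (auto simp: G_carrier[of _ 2])

text \<open>The key step: coproduct families multiply. Write \<open>b = e + w\<close> and \<open>b' = e' + w'\<close>. The terms
  in the cup product of the product family sum to
  \<open>-e dw' - e' dw + w' \<union> w + w \<union> w' - dw' \<union>\<^sub>1 w - dw \<union>\<^sub>1 w' + dw \<circ> dw'\<close>, and the formula for
  \<open>d(w \<union>\<^sub>1 w')\<close> identifies this with \<open>-d\<close> of the \<open>A\<^sup>1\<close>-component \<open>ew' + e'w + w \<union>\<^sub>1 w'\<close> of
  \<open>bb'\<close>. The formula applies because the last condition on a coproduct family puts \<open>dw\<close> and \<open>dw'\<close>
  in \<open>D\<^sup>2(A)\<close>.\<close>

lemma coproduct_family_mult:
  assumes fS: "coproduct_family S x y b" and fT: "coproduct_family T x' y' b'"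
  shows "coproduct_family (S \<times> T) (\<lambda>z. x (fst z) \<otimes>\<^bsub>B\<^esub> x' (snd z))
           (\<lambda>z. y (fst z) \<otimes>\<^bsub>B\<^esub> y' (snd z)) (b \<otimes>\<^bsub>B\<^esub> b')"
proof -
  have c: "\<And>i. i \<in> S \<Longrightarrow> x i \<in> carrier B" "\<And>i. i \<in> S \<Longrightarrow> y i \<in> carrier B"
    "\<And>j. j \<in> T \<Longrightarrow> x' j \<in> carrier B" "\<And>j. j \<in> T \<Longrightarrow> y' j \<in> carrier B"
    and b: "b \<in> carrier B" "b' \<in> carrier B" and fin: "finite S" "finite T"
    using assms by (auto simp: coproduct_family_def)
  have [simp]: "\<And>i. i \<in> S \<Longrightarrow> fst (x i) \<in> carrier (Zp p)" "\<And>i. i \<in> S \<Longrightarrow> snd (x i) \<in> G 1"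
    "\<And>i. i \<in> S \<Longrightarrow> fst (y i) \<in> carrier (Zp p)" "\<And>i. i \<in> S \<Longrightarrow> snd (y i) \<in> G 1"
    "\<And>j. j \<in> T \<Longrightarrow> fst (x' j) \<in> carrier (Zp p)" "\<And>j. j \<in> T \<Longrightarrow> snd (x' j) \<in> G 1"
    "\<And>j. j \<in> T \<Longrightarrow> fst (y' j) \<in> carrier (Zp p)" "\<And>j. j \<in> T \<Longrightarrow> snd (y' j) \<in> G 1"
    using c fst_snd_B by blast+
  note [simp] = G_carrier[of _ 1] G_carrier[of _ 2]
  obtain circ where circ: "bilinear_on (Zp p) A D2 D2 D2 circ"
    and circ_cup: "\<And>u v w z. \<lbrakk>u \<in> G 1; v \<in> G 1; w \<in> G 1; z \<in> G 1\<rbrakk> \<Longrightarrow>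
            circ (u \<otimes> v) (w \<otimes> z) = cup1 u w \<otimes> cup1 v z"
    and d_cup1: "\<And>a b. \<lbrakk>a \<in> G 1; b \<in> G 1; d a \<in> D2; d b \<in> D2\<rbrakk> \<Longrightarrow>
            d (cup1 a b) = (\<ominus> (a \<otimes> b)) \<ominus> b \<otimes> a \<oplus> cup1 (d a) b \<oplus> cup1 (d b) a
                \<ominus> circ (d a) (d b)"
    using ex_circ by blast
  define e w e' w' where "e = fst b" "w = snd b" "e' = fst b'" "w' = snd b'"
  note ew = this
  have ew_closed [simp]: "e \<in> carrier (Zp p)" "w \<in> G 1" "e' \<in> carrier (Zp p)" "w' \<in> G 1"
    using b fst_snd_B by (auto simp: ew)
  note sumS = coproduct_family_sums[OF fS, folded ew]
  note sumT = coproduct_family_sums[OF fT, folded ew]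
  have D2c: "add_closed A D2"
    by (rule submodule_add_closed[OF D2_submodule])
  have d_D2: "d t \<in> D2" if "\<And>i. i \<in> K \<Longrightarrow> f i \<in> G 1" "\<And>i. i \<in> K \<Longrightarrow> g i \<in> G 1"
    "(\<Oplus>i\<in>K. f i \<otimes> g i) = \<ominus> d t" "t \<in> G 1" for t f g and K :: "'k set"
  proof -
    have "\<ominus> d t \<in> D2"
      unfolding that(3)[symmetric] using that
      by (intro finsum_in_add_closed[OF D2c]) (auto intro: cup_in_D2)
    then show ?thesis
      using submoduleE(3)[OF D2_submodule] that(4) by (metis d_G2 G_carrier minus_minus)
  qed
  have dwD: "d w \<in> D2" "d w' \<in> D2"
    using d_D2[OF _ _ sumS(4)] d_D2[OF _ _ sumT(4)] by auto
  let ?F1 = "\<lambda>z. (fst (x (fst z)) \<otimes>\<^bsub>Zp p\<^esub> fst (y (fst z))) \<odot> (snd (x' (snd z)) \<otimes> snd (y' (snd z)))"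
  let ?F2 = "\<lambda>z. (fst (x' (snd z)) \<otimes>\<^bsub>Zp p\<^esub> fst (y' (snd z))) \<odot> (snd (x (fst z)) \<otimes> snd (y (fst z)))"
  let ?F3 = "\<lambda>z. (fst (y' (snd z)) \<odot> snd (x' (snd z))) \<otimes> (fst (x (fst z)) \<odot> snd (y (fst z)))"
  let ?F4 = "\<lambda>z. (fst (y (fst z)) \<odot> snd (x (fst z))) \<otimes> (fst (x' (snd z)) \<odot> snd (y' (snd z)))"
  let ?F5 = "\<lambda>z. snd (x' (snd z)) \<otimes> cup1 (fst (x (fst z)) \<odot> snd (y (fst z))) (snd (y' (snd z)))
    \<oplus> cup1 (fst (y (fst z)) \<odot> snd (x (fst z))) (snd (x' (snd z))) \<otimes> snd (y' (snd z))"
  let ?F6 = "\<lambda>z. snd (x (fst z)) \<otimes> cup1 (fst (x' (snd z)) \<odot> snd (y' (snd z))) (snd (y (fst z)))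
    \<oplus> cup1 (fst (y' (snd z)) \<odot> snd (x' (snd z))) (snd (x (fst z))) \<otimes> snd (y (fst z))"
  let ?F7 = "\<lambda>z. cup1 (snd (x (fst z))) (snd (x' (snd z))) \<otimes> cup1 (snd (y (fst z))) (snd (y' (snd z)))"
  have cl: "?F1 \<in> S \<times> T \<rightarrow> carrier A" "?F2 \<in> S \<times> T \<rightarrow> carrier A" "?F3 \<in> S \<times> T \<rightarrow> carrier A"
    "?F4 \<in> S \<times> T \<rightarrow> carrier A" "?F5 \<in> S \<times> T \<rightarrow> carrier A" "?F6 \<in> S \<times> T \<rightarrow> carrier A"
    "?F7 \<in> S \<times> T \<rightarrow> carrier A"
    by auto
  note ag = abelian_group_axioms
  have "(\<Oplus>z\<in>S \<times> T. snd (x (fst z) \<otimes>\<^bsub>B\<^esub> x' (snd z)) \<otimes> snd (y (fst z) \<otimes>\<^bsub>B\<^esub> y' (snd z)))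
      = (\<Oplus>z\<in>S \<times> T. (?F1 z \<oplus> ?F2 z) \<oplus> (?F3 z \<oplus> ?F4 z) \<oplus> ?F5 z \<oplus> ?F6 z \<oplus> ?F7 z)"
  proof (rule finsum_cong'[OF refl])
    fix z assume "z \<in> S \<times> T"
    then have "fst z \<in> S" "snd z \<in> T"
      by auto
    then show "snd (x (fst z) \<otimes>\<^bsub>B\<^esub> x' (snd z)) \<otimes> snd (y (fst z) \<otimes>\<^bsub>B\<^esub> y' (snd z))
      = (?F1 z \<oplus> ?F2 z) \<oplus> (?F3 z \<oplus> ?F4 z) \<oplus> ?F5 z \<oplus> ?F6 z \<oplus> ?F7 z"
      unfolding B_sel(7) by (intro cup_of_products) simp_all
  qed (use cl in \<open>auto simp: Pi_def\<close>)
  also have "\<dots> = (finsum A ?F1 (S \<times> T) \<oplus> finsum A ?F2 (S \<times> T))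
      \<oplus> (finsum A ?F3 (S \<times> T) \<oplus> finsum A ?F4 (S \<times> T))
      \<oplus> finsum A ?F5 (S \<times> T) \<oplus> finsum A ?F6 (S \<times> T) \<oplus> finsum A ?F7 (S \<times> T)"
    using cl by (simp add: finsum_addf Pi_def)
  also have "finsum A ?F1 (S \<times> T) = e \<odot> (\<ominus> d w')"
    unfolding sumS(1)[symmetric] sumT(4)[symmetric]
    by (rule biadditive_finsum[OF R.abelian_group_axioms ag ag R.add_closed_carrier
          add_closed_carrier, where f = "smult A"])
      (auto simp: smult_l_distr smult_r_distr fin)
  also have "finsum A ?F2 (S \<times> T) = e' \<odot> (\<ominus> d w)"
    unfolding sumS(4)[symmetric] sumT(1)[symmetric]
    by (rule biadditive_finsum[OF ag R.abelian_group_axioms ag add_closed_carrier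
          R.add_closed_carrier, where f = "\<lambda>t r. r \<odot> t"])
      (auto simp: smult_l_distr smult_r_distr fin)
  also have "finsum A ?F3 (S \<times> T) = w' \<otimes> w"
    unfolding sumS(2)[symmetric] sumT(3)[symmetric]
    by (rule biadditive_finsum[OF ag ag ag add_closed_carrier add_closed_carrier,
          where f = "\<lambda>t t'. t' \<otimes> t"])
      (auto simp: l_distr r_distr fin)
  also have "finsum A ?F4 (S \<times> T) = w \<otimes> w'"
    unfolding sumS(3)[symmetric] sumT(2)[symmetric]
    by (rule biadditive_finsum[OF ag ag ag add_closed_carrier add_closed_carrier,
          where f = "\<lambda>t t'. t \<otimes> t'"])
      (auto simp: l_distr r_distr fin)
  also have "finsum A ?F5 (S \<times> T) = cup1 (\<ominus> d w') w"
  proof -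
    have "finsum A ?F5 (S \<times> T) = (\<Oplus>j\<in>T. \<Oplus>i\<in>S. ?F5 (i, j))"
      using finsum_cartesian_product_swap[OF fin, of "\<lambda>i j. ?F5 (i, j)"] by simp
    also have "\<dots> = (\<Oplus>j\<in>T. cup1 (snd (x' j) \<otimes> snd (y' j)) w)"
      using Hirsch_sum[where S = S and x = "\<lambda>i. fst (x i) \<odot> snd (y i)"
          and y = "\<lambda>i. fst (y i) \<odot> snd (x i)" and w = w] sumS(2,3)
      by (intro finsum_cong') auto
    also have "\<dots> = cup1 (\<ominus> d w') w"
      by (simp add: cup1_finsum sumT(4))
    finally show ?thesis .
  qed
  also have "finsum A ?F6 (S \<times> T) = cup1 (\<ominus> d w) w'"
  proof -
    have "finsum A ?F6 (S \<times> T) = (\<Oplus>i\<in>S. \<Oplus>j\<in>T. ?F6 (i, j))"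
      using finsum_cartesian_product[OF fin, of "\<lambda>i j. ?F6 (i, j)"] by simp
    also have "\<dots> = (\<Oplus>i\<in>S. cup1 (snd (x i) \<otimes> snd (y i)) w')"
      using Hirsch_sum[where S = T and x = "\<lambda>i. fst (x' i) \<odot> snd (y' i)"
          and y = "\<lambda>i. fst (y' i) \<odot> snd (x' i)" and w = w'] sumT(2,3)
      by (intro finsum_cong') auto
    also have "\<dots> = cup1 (\<ominus> d w) w'"
      by (simp add: cup1_finsum sumS(4))
    finally show ?thesis .
  qed
  also have "finsum A ?F7 (S \<times> T) = circ (\<ominus> d w) (\<ominus> d w')"
  proof -
    have "finsum A ?F7 (S \<times> T) = (\<Oplus>z\<in>S \<times> T. circ (snd (x (fst z)) \<otimes> snd (y (fst z)))
        (snd (x' (snd z)) \<otimes> snd (y' (snd z))))"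
      by (rule finsum_cong') (auto simp: circ_cup)
    also have "\<dots> = circ (\<ominus> d w) (\<ominus> d w')"
      unfolding sumS(4)[symmetric] sumT(4)[symmetric]
      using circ submoduleE(1)[OF D2_submodule]
      by (intro biadditive_finsum[OF ag ag ag D2c D2c, where f = circ])
        (auto simp: bilinear_on_def fin cup_in_D2)
    finally show ?thesis .
  qed
  also have "(e \<odot> (\<ominus> d w') \<oplus> e' \<odot> (\<ominus> d w)) \<oplus> (w' \<otimes> w \<oplus> w \<otimes> w')
      \<oplus> cup1 (\<ominus> d w') w \<oplus> cup1 (\<ominus> d w) w' \<oplus> circ (\<ominus> d w) (\<ominus> d w')
    = \<ominus> d (snd (b \<otimes>\<^bsub>B\<^esub> b'))"
  proof -
    have D2A: "D2 \<subseteq> carrier A"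
      using submoduleE(1)[OF D2_submodule] .
    have c: "circ (d w) (d w') \<in> carrier A"
      using circ dwD D2A unfolding bilinear_on_def by blast
    have "circ (\<ominus> d w) (\<ominus> d w') = circ (d w) (d w')"
      using bilinear_on_minus[OF circ D2A D2A D2A] dwD submoduleE(3)[OF D2_submodule] c by simp
    moreover have "d (snd (b \<otimes>\<^bsub>B\<^esub> b')) = e \<odot> d w' \<oplus> e' \<odot> d w \<oplus> d (cup1 w w')"
      unfolding B_sel(7) ew[symmetric] by (simp add: d_add d_smult)
    ultimately show ?thesis
      using c dwD by (simp add: d_cup1 smult_r_minus minus_add a_minus_def a_ac)
  qed
  finally have "(\<Oplus>z\<in>S \<times> T. snd (x (fst z) \<otimes>\<^bsub>B\<^esub> x' (snd z)) \<otimes> snd (y (fst z) \<otimes>\<^bsub>B\<^esub> y' (snd z)))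
    = \<ominus> d (snd (b \<otimes>\<^bsub>B\<^esub> b'))" .
  then show ?thesis
    using assms counit_mult[OF fin, of x y x' y'] counit_mult[OF fin, of y x y' x'] c
    by (auto simp: coproduct_family_def)
qed

section \<open>Zeta elements and falling factorials\<close>

text \<open>The residue class of \<open>n\<close>.\<close>

abbreviation zp :: "nat \<Rightarrow> int" where
  "zp n \<equiv> [n] \<cdot>\<^bsub>Zp p\<^esub> \<one>\<^bsub>Zp p\<^esub>"

lemma zp_closed [simp]: "zp n \<in> carrier (Zp p)"
  by (rule R.add.nat_pow_closed) simp

lemma zp_add: "zp (m + n) = zp m \<oplus>\<^bsub>Zp p\<^esub> zp n"
  by (simp add: R.add.nat_pow_mult)

lemma zp_mult: "zp (m * n) = zp m \<otimes>\<^bsub>Zp p\<^esub> zp n"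
  by (simp add: R.add_pow_ldistr R.add.nat_pow_pow mult.commute)

lemma zp_eq: "zp n = int n mod int p"
proof (induction n)
  case (Suc n)
  have "zp (Suc n) = zp n \<oplus>\<^bsub>Zp p\<^esub> \<one>\<^bsub>Zp p\<^esub>"
    by (rule R.add.nat_pow_Suc)
  also have "\<dots> = (zp n + 1) mod int p"
    by (simp only: residue_ring_def ring_record_simps)
  finally show ?case
    by (simp add: Suc mod_simps add.commute)
next
  case 0
  have "zp 0 = \<zero>\<^bsub>Zp p\<^esub>"
    by (rule R.add.nat_pow_0)
  then show ?case
    by (simp add: residue_ring_def)
qed

lemma zp_unit:
  assumes "prime p" "0 < n" "n < p"
  shows "zp n \<in> Units (Zp p)"
proof -
  interpret res: residues "int p" "Zp p"
    using prime_gt_1_nat[OF assms(1)] by unfold_locales auto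
  have "coprime (int n) (int p)"
    using prime_imp_coprime[OF assms(1)] nat_dvd_not_less[OF assms(2,3)] by (simp add: coprime_commute)
  then show ?thesis
    using assms by (simp add: zp_eq res.res_units_eq)
qed

lemma zp_fact_unit:
  assumes "prime p" "n < p"
  shows "zp (fact n) \<in> Units (Zp p)"
  using assms(2)
proof (induction n)
  case 0
  then show ?case
    by simp
next
  case (Suc n)
  have "zp (fact (Suc n)) = zp (Suc n) \<otimes>\<^bsub>Zp p\<^esub> zp (fact n)"
    by (simp add: zp_mult del: of_nat_Suc mult_Suc add_pow_def)
  then show ?case
    using Suc zp_unit[OF assms(1), of "Suc n"] by simp
qed

lemma zp_inv_fact:
  assumes "prime p" "Suc n < p"
  shows "zp (Suc n) \<otimes>\<^bsub>Zp p\<^esub> inv\<^bsub>Zp p\<^esub> zp (fact (Suc n)) = inv\<^bsub>Zp p\<^esub> zp (fact n)"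
proof -
  have u: "zp (fact (Suc n)) \<in> Units (Zp p)" "zp (fact n) \<in> Units (Zp p)"
    using assms by (auto intro: zp_fact_unit simp del: fact_Suc)
  have "zp (fact (Suc n)) = zp (fact n) \<otimes>\<^bsub>Zp p\<^esub> zp (Suc n)"
    by (simp only: zp_mult[symmetric] fact_Suc of_nat_id mult.commute)
  then have "zp (fact n) \<otimes>\<^bsub>Zp p\<^esub> (zp (Suc n) \<otimes>\<^bsub>Zp p\<^esub> inv\<^bsub>Zp p\<^esub> zp (fact (Suc n))) = \<one>\<^bsub>Zp p\<^esub>"
    using u(1) R.Units_r_inv[OF u(1)] by (simp add: R.m_assoc[symmetric] del: fact_Suc)
  then show ?thesis
    using u by (intro R.comm_inv_char[symmetric]) (auto simp del: fact_Suc)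
qed

lemma B_of_nat: "[n] \<cdot>\<^bsub>B\<^esub> \<one>\<^bsub>B\<^esub> = zp n \<odot>\<^bsub>B\<^esub> \<one>\<^bsub>B\<^esub>"
  by (induction n) (simp_all add: B.smult_l_distr)

lemma falling_closed: "b \<in> carrier B \<Longrightarrow> falling B n b \<in> carrier B"
  unfolding falling_def by (intro B.finprod_closed) auto

lemma falling_Suc:
  assumes "b \<in> carrier B"
  shows "falling B (Suc n) b = falling B n b \<otimes>\<^bsub>B\<^esub> (b \<ominus>\<^bsub>B\<^esub> zp n \<odot>\<^bsub>B\<^esub> \<one>\<^bsub>B\<^esub>)"
  using assms unfolding falling_def lessThan_Suc
  by (subst B.finprod_insert) (auto simp: B_of_nat B.m_comm)

lemma falling_0: "falling B 0 b = \<one>\<^bsub>B\<^esub>"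
  by (simp add: falling_def)

lemma zeta_closed:
  assumes "prime p" "n < p" "b \<in> carrier B"
  shows "zeta p B n b \<in> carrier B"
  unfolding zeta_def using zp_fact_unit[OF assms(1,2)] falling_closed[OF assms(3)]
  by (intro B.smult_closed) auto

lemma zeta_0: "zeta p B 0 b = \<one>\<^bsub>B\<^esub>"
  by (simp add: zeta_def falling_0)

text \<open>The recursion \<open>\<zeta>\<^sub>k(b) b = (k + 1) \<zeta>\<^sub>k\<^sub>+\<^sub>1(b) + k \<zeta>\<^sub>k(b)\<close>, that is, \<open>(k + 1) \<zeta>\<^sub>k\<^sub>+\<^sub>1(b) = \<zeta>\<^sub>k(b) (b - k)\<close>.\<close>

lemma zeta_mult:
  assumes "prime p" "Suc k < p" "b \<in> carrier B"
  shows "zeta p B k b \<otimes>\<^bsub>B\<^esub> b = zp (Suc k) \<odot>\<^bsub>B\<^esub> zeta p B (Suc k) b \<oplus>\<^bsub>B\<^esub> zp k \<odot>\<^bsub>B\<^esub> zeta p B k b"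
proof -
  define c where "c = inv\<^bsub>Zp p\<^esub> zp (fact k)"
  have u: "zp (fact (Suc k)) \<in> Units (Zp p)" "zp (fact k) \<in> Units (Zp p)"
    using assms by (auto intro: zp_fact_unit simp del: fact_Suc)
  have c: "c \<in> carrier (Zp p)"
    using u by (simp add: c_def)
  define f where "f = falling B k b"
  have f: "f \<in> carrier B"
    using assms by (simp add: f_def falling_closed)
  note b = assms(3)
  have zk: "zeta p B k b = c \<odot>\<^bsub>B\<^esub> f"
    by (simp add: zeta_def c_def f_def)
  have "zp (Suc k) \<odot>\<^bsub>B\<^esub> zeta p B (Suc k) b
      = (zp (Suc k) \<otimes>\<^bsub>Zp p\<^esub> inv\<^bsub>Zp p\<^esub> zp (fact (Suc k))) \<odot>\<^bsub>B\<^esub> falling B (Suc k) b"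
    unfolding zeta_def using u falling_closed[OF b]
    by (intro B.smult_assoc1[symmetric]) (auto simp del: fact_Suc)
  also have "\<dots> = c \<odot>\<^bsub>B\<^esub> falling B (Suc k) b"
    by (simp only: zp_inv_fact[OF assms(1,2)] c_def)
  also have "falling B (Suc k) b = f \<otimes>\<^bsub>B\<^esub> b \<ominus>\<^bsub>B\<^esub> zp k \<odot>\<^bsub>B\<^esub> f"
    using b f by (simp add: falling_Suc f_def[symmetric] a_minus_def B.r_distr B.r_minus B_smult_mult_right)
  also have "c \<odot>\<^bsub>B\<^esub> (f \<otimes>\<^bsub>B\<^esub> b \<ominus>\<^bsub>B\<^esub> zp k \<odot>\<^bsub>B\<^esub> f)
      = zeta p B k b \<otimes>\<^bsub>B\<^esub> b \<ominus>\<^bsub>B\<^esub> zp k \<odot>\<^bsub>B\<^esub> zeta p B k b"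
    using b f c
    by (simp add: zk a_minus_def B.smult_r_distr B.smult_r_minus B.smult_assoc2
        B.smult_assoc1[symmetric] R.m_comm)
  finally show ?thesis
    using b f c by (simp add: zk a_minus_def B.a_assoc B.l_neg)
qed

lemma fst_zeta:
  assumes "prime p" "n < p" "a \<in> G 1"
  shows "fst (zeta p B n (\<zero>\<^bsub>Zp p\<^esub>, a)) = (if n = 0 then \<one>\<^bsub>Zp p\<^esub> else \<zero>\<^bsub>Zp p\<^esub>)"
proof -
  let ?b = "(\<zero>\<^bsub>Zp p\<^esub>, a)"
  have b: "?b \<in> carrier B"
    using assms by (simp add: B_sel)
  have "fst (falling B (Suc m) ?b) = \<zero>\<^bsub>Zp p\<^esub>" for m
  proof (induction m)
    case 0
    have "falling B (Suc 0) ?b = ?b"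
      unfolding falling_Suc[OF b] falling_0 using b by (simp add: B_of_nat[symmetric] a_minus_def)
    then show ?case
      by simp
  next
    case (Suc m)
    have "fst (?b \<ominus>\<^bsub>B\<^esub> zp (Suc m) \<odot>\<^bsub>B\<^esub> \<one>\<^bsub>B\<^esub>) \<in> carrier (Zp p)"
      using b by (intro fst_snd_B(1)) auto
    then show ?case
      unfolding falling_Suc[OF b, of "Suc m"] B_sel(6) Suc by simp
  qed
  then have "fst (falling B n ?b) = \<zero>\<^bsub>Zp p\<^esub>" if "n \<noteq> 0"
    using that by (cases n) auto
  then show ?thesis
    using zp_fact_unit[OF assms(1,2)] by (cases "n = 0") (simp_all add: zeta_0 B_sel(2), simp add: zeta_def B_sel(8))
qed

section \<open>Coproduct families for zeta elements\<close>

lemma smult_unit_cancel: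
  assumes "u \<in> Units (Zp p)" "x \<in> carrier A" "y \<in> carrier A" "u \<odot> x = u \<odot> y"
  shows "x = y"
proof -
  have "x = inv\<^bsub>Zp p\<^esub> u \<odot> (u \<odot> x)"
    using assms(1,2) by (simp add: smult_assoc1[symmetric] R.Units_closed)
  also have "\<dots> = y"
    unfolding assms(4) using assms(1,3) by (simp add: smult_assoc1[symmetric] R.Units_closed)
  finally show ?thesis .
qed

lemma coproduct_family_reindex:
  assumes "coproduct_family S x y b" "inj_on h S"
    and "\<And>i. i \<in> S \<Longrightarrow> x' (h i) = x i" "\<And>i. i \<in> S \<Longrightarrow> y' (h i) = y i"
  shows "coproduct_family (h ` S) x' y' b"
proof -
  have c: "x i \<in> carrier B" "y i \<in> carrier B" "fst (x i) \<in> carrier (Zp p)" "fst (y i) \<in> carrier (Zp p)"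
    "snd (x i) \<in> carrier A" "snd (y i) \<in> carrier A" if "i \<in> S" for i
    using assms(1) that fst_snd_B[of "x i"] fst_snd_B[of "y i"] G_carrier[of _ 1]
    by (auto simp: coproduct_family_def)
  have "(\<Oplus>\<^bsub>B\<^esub>i\<in>h ` S. fst (x' i) \<odot>\<^bsub>B\<^esub> y' i) = (\<Oplus>\<^bsub>B\<^esub>i\<in>S. fst (x' (h i)) \<odot>\<^bsub>B\<^esub> y' (h i))"
    "(\<Oplus>\<^bsub>B\<^esub>i\<in>h ` S. fst (y' i) \<odot>\<^bsub>B\<^esub> x' i) = (\<Oplus>\<^bsub>B\<^esub>i\<in>S. fst (y' (h i)) \<odot>\<^bsub>B\<^esub> x' (h i))"
    using assms c by (auto intro!: B.finsum_reindex)
  moreover have "(\<Oplus>i\<in>h ` S. snd (x' i) \<otimes> snd (y' i)) = (\<Oplus>i\<in>S. snd (x' (h i)) \<otimes> snd (y' (h i)))"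
    using assms c by (auto intro!: finsum_reindex)
  moreover have "(\<Oplus>\<^bsub>B\<^esub>i\<in>S. fst (x' (h i)) \<odot>\<^bsub>B\<^esub> y' (h i)) = (\<Oplus>\<^bsub>B\<^esub>i\<in>S. fst (x i) \<odot>\<^bsub>B\<^esub> y i)"
    "(\<Oplus>\<^bsub>B\<^esub>i\<in>S. fst (y' (h i)) \<odot>\<^bsub>B\<^esub> x' (h i)) = (\<Oplus>\<^bsub>B\<^esub>i\<in>S. fst (y i) \<odot>\<^bsub>B\<^esub> x i)"
    using assms c by (auto intro!: B.finsum_cong')
  moreover have "(\<Oplus>i\<in>S. snd (x' (h i)) \<otimes> snd (y' (h i))) = (\<Oplus>i\<in>S. snd (x i) \<otimes> snd (y i))"
    using assms c by (auto intro!: finsum_cong')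
  ultimately show ?thesis
    using assms c by (auto simp: coproduct_family_def)
qed

lemma coproduct_family_unit:
  "coproduct_family {i} (\<lambda>_. \<one>\<^bsub>B\<^esub>) (\<lambda>_. \<one>\<^bsub>B\<^esub>) \<one>\<^bsub>B\<^esub>"
proof -
  have "d \<zero> = \<zero>"
    using d_smult[of "\<zero>\<^bsub>Zp p\<^esub>" \<zero>] d_G2[of \<zero>] G_carrier[of "d \<zero>" 2] by simp
  then show ?thesis
    by (simp add: coproduct_family_def B_sel(2)[THEN arg_cong, of fst] B_sel(2)[THEN arg_cong, of snd])
qed

text \<open>A cocycle \<open>a\<close> is primitive: its family is \<open>1 \<otimes> a + a \<otimes> 1\<close>, indexed by the booleans.\<close>

lemma coproduct_family_cocycle:
  assumes "a \<in> G 1" "d a = \<zero>"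
  defines "b \<equiv> (\<zero>\<^bsub>Zp p\<^esub>, a)"
  shows "coproduct_family UNIV (\<lambda>i. if i then b else \<one>\<^bsub>B\<^esub>) (\<lambda>i. if i then \<one>\<^bsub>B\<^esub> else b) b"
proof -
  have b: "b \<in> carrier B" "fst b = \<zero>\<^bsub>Zp p\<^esub>" "snd b = a"
    using assms by (simp_all add: B_sel)
  have "fst \<one>\<^bsub>B\<^esub> = \<one>\<^bsub>Zp p\<^esub>" "snd \<one>\<^bsub>B\<^esub> = \<zero>"
    by (simp_all add: B_sel(2))
  then show ?thesis
    using b assms(1,2) by (simp add: coproduct_family_def UNIV_bool G_carrier[of a 1])
qed

lemma zeta_counit:
  assumes "prime p" "k < p" "a \<in> G 1"
  defines "z \<equiv> \<lambda>n. zeta p B n (\<zero>\<^bsub>Zp p\<^esub>, a)"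
  shows "(\<Oplus>\<^bsub>B\<^esub>l\<in>{..k}. fst (z l) \<odot>\<^bsub>B\<^esub> z (k - l)) = z k"
    and "(\<Oplus>\<^bsub>B\<^esub>l\<in>{..k}. fst (z (k - l)) \<odot>\<^bsub>B\<^esub> z l) = z k"
proof -
  have zc: "z n \<in> carrier B" if "n \<le> k" for n
    unfolding z_def using assms that by (intro zeta_closed) (auto simp: B_sel)
  have fz: "fst (z n) = (if n = 0 then \<one>\<^bsub>Zp p\<^esub> else \<zero>\<^bsub>Zp p\<^esub>)" if "n \<le> k" for n
    unfolding z_def using assms that by (intro fst_zeta) auto
  have "(\<Oplus>\<^bsub>B\<^esub>l\<in>{..k}. fst (z l) \<odot>\<^bsub>B\<^esub> z (k - l)) = (\<Oplus>\<^bsub>B\<^esub>l\<in>{..k}. if 0 = l then z k else \<zero>\<^bsub>B\<^esub>)"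
    using zc fz by (intro B.finsum_cong') auto
  also have "\<dots> = z k"
    using zc by (intro B.finsum_singleton) auto
  finally show "(\<Oplus>\<^bsub>B\<^esub>l\<in>{..k}. fst (z l) \<odot>\<^bsub>B\<^esub> z (k - l)) = z k" .
  have "(\<Oplus>\<^bsub>B\<^esub>l\<in>{..k}. fst (z (k - l)) \<odot>\<^bsub>B\<^esub> z l) = (\<Oplus>\<^bsub>B\<^esub>l\<in>{..k}. if k = l then z k else \<zero>\<^bsub>B\<^esub>)"
    using zc fz by (intro B.finsum_cong') auto
  also have "\<dots> = z k"
    using zc by (intro B.finsum_singleton) auto
  finally show "(\<Oplus>\<^bsub>B\<^esub>l\<in>{..k}. fst (z (k - l)) \<odot>\<^bsub>B\<^esub> z l) = z k" .
qed

text \<open>The divided power coproduct \<open>\<zeta>\<^sub>k(a) \<mapsto> \<Sum>\<^sub>l \<zeta>\<^sub>l(a) \<otimes> \<zeta>\<^sub>k\<^sub>-\<^sub>l(a)\<close>. In the induction step, the product of the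
  family for \<open>\<zeta>\<^sub>k(a)\<close> with that for \<open>a\<close> is expanded by the recursion for \<open>\<zeta>\<close>, as in the proof of the
  Vandermonde identity; this gives \<open>k + 1\<close> times the last condition for \<open>\<zeta>\<^sub>k\<^sub>+\<^sub>1(a)\<close>, and
  \<open>k + 1\<close> is invertible modulo \<open>p\<close>. The counit equations hold because \<open>\<zeta>\<^sub>n(a)\<close> has augmentation 0
  for \<open>n \<ge> 1\<close>.\<close>

lemma coproduct_family_zeta:
  assumes "prime p" "k < p" "a \<in> G 1" "d a = \<zero>"
  defines "z \<equiv> \<lambda>n. zeta p B n (\<zero>\<^bsub>Zp p\<^esub>, a)"
  shows "coproduct_family {..k} z (\<lambda>l. z (k - l)) (z k)"
  using assms(2)
proof (induction k)
  case 0
  have "z 0 = \<one>\<^bsub>B\<^esub>"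
    by (simp add: z_def zeta_0)
  then show ?case
    using coproduct_family_reindex[OF coproduct_family_unit, of "\<lambda>i. i" "0::nat" z "\<lambda>l. z (0 - l)"]
    by simp
next
  case (Suc k)
  define b where "b = (\<zero>\<^bsub>Zp p\<^esub>, a)"
  have b: "b \<in> carrier B"
    using assms by (simp add: b_def B_sel)
  have zc [simp]: "z n \<in> carrier B" if "n \<le> Suc k" for n
    unfolding z_def using assms b that Suc.prems by (intro zeta_closed) (auto simp: b_def)
  have sz [simp]: "snd (z n) \<in> G 1" if "n \<le> Suc k" for n
    using zc[OF that] fst_snd_B by blast
  note [simp] = G_carrier[of _ 1] G_carrier[of _ 2]
  have IH: "coproduct_family {..k} z (\<lambda>l. z (k - l)) (z k)"
    using Suc by simp
  have zb: "snd (z n \<otimes>\<^bsub>B\<^esub> b) = zp (Suc n) \<odot> snd (z (Suc n)) \<oplus> zp n \<odot> snd (z n)" if "n \<le> k" for n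
    using zeta_mult[OF assms(1) _ b, of n] that Suc.prems
    unfolding z_def b_def by (simp only: B_sel(5,9))
  have [simp]: "snd (z n \<otimes>\<^bsub>B\<^esub> b) \<in> G 1" if "n \<le> k" for n
    using that b by (intro fst_snd_B) auto
  let ?N = "\<lambda>m n. snd (z m) \<otimes> snd (z n)"
  let ?SN = "\<Oplus>l\<in>{..k}. ?N l (k - l)"
  let ?SN' = "\<Oplus>l\<in>{..Suc k}. ?N l (Suc k - l)"
  have SN: "?SN = \<ominus> d (snd (z k))"
    using coproduct_family_sums(4)[OF IH] .
  have "\<ominus> d (snd (z k \<otimes>\<^bsub>B\<^esub> b))
      = (\<Oplus>i\<in>{..k} \<times> UNIV. snd (z (fst i) \<otimes>\<^bsub>B\<^esub> (if snd i then b else \<one>\<^bsub>B\<^esub>))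
          \<otimes> snd (z (k - fst i) \<otimes>\<^bsub>B\<^esub> (if snd i then \<one>\<^bsub>B\<^esub> else b)))"
    using coproduct_family_sums(4)[OF coproduct_family_mult[OF IH
          coproduct_family_cocycle[OF assms(3,4), folded b_def]]] by simp
  also have "\<dots> = (\<Oplus>l\<in>{..k}. \<Oplus>i\<in>UNIV. snd (z l \<otimes>\<^bsub>B\<^esub> (if i then b else \<one>\<^bsub>B\<^esub>))
          \<otimes> snd (z (k - l) \<otimes>\<^bsub>B\<^esub> (if i then \<one>\<^bsub>B\<^esub> else b)))"
    by (rule finsum_cartesian_product) auto
  also have "\<dots> = (\<Oplus>l\<in>{..k}. (zp (Suc l) \<odot> ?N (Suc l) (k - l) \<oplus> zp (Suc k - l) \<odot> ?N l (Suc k - l))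
      \<oplus> zp k \<odot> ?N l (k - l))"
  proof (rule finsum_cong'[OF refl])
    fix l assume l: "l \<in> {..k}"
    have zpk: "zp k = zp l \<oplus>\<^bsub>Zp p\<^esub> zp (k - l)"
      using l by (simp add: zp_add[symmetric])
    have "(\<Oplus>i\<in>UNIV. snd (z l \<otimes>\<^bsub>B\<^esub> (if i then b else \<one>\<^bsub>B\<^esub>))
          \<otimes> snd (z (k - l) \<otimes>\<^bsub>B\<^esub> (if i then \<one>\<^bsub>B\<^esub> else b)))
      = snd (z l) \<otimes> snd (z (k - l) \<otimes>\<^bsub>B\<^esub> b) \<oplus> snd (z l \<otimes>\<^bsub>B\<^esub> b) \<otimes> snd (z (k - l))"
      using l by (simp add: UNIV_bool)
    then show "(\<Oplus>i\<in>UNIV. snd (z l \<otimes>\<^bsub>B\<^esub> (if i then b else \<one>\<^bsub>B\<^esub>))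
          \<otimes> snd (z (k - l) \<otimes>\<^bsub>B\<^esub> (if i then \<one>\<^bsub>B\<^esub> else b)))
      = (zp (Suc l) \<odot> ?N (Suc l) (k - l) \<oplus> zp (Suc k - l) \<odot> ?N l (Suc k - l)) \<oplus> zp k \<odot> ?N l (k - l)"
      using l by (simp add: zb Suc_diff_le zpk l_distr r_distr smult_mult_left smult_mult_right
          smult_l_distr a_ac del: add.nat_pow_Suc R.add.nat_pow_Suc)
  qed auto
  also have "\<dots> = ((\<Oplus>l\<in>{..k}. zp (Suc l) \<odot> ?N (Suc l) (k - l))
      \<oplus> (\<Oplus>l\<in>{..k}. zp (Suc k - l) \<odot> ?N l (Suc k - l))) \<oplus> (\<Oplus>l\<in>{..k}. zp k \<odot> ?N l (k - l))"
    by (simp add: finsum_addf Pi_def del: add.nat_pow_Suc R.add.nat_pow_Suc)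
  \<comment> \<open>Both sums extend to \<open>l \<le> k + 1\<close>, the first after a shift: the added terms have coefficient 0.\<close>
  also have "(\<Oplus>l\<in>{..k}. zp (Suc l) \<odot> ?N (Suc l) (k - l)) = (\<Oplus>l\<in>{..Suc k}. zp l \<odot> ?N l (Suc k - l))"
    by (subst finsum_Suc2) (auto simp del: add.nat_pow_Suc R.add.nat_pow_Suc)
  also have "(\<Oplus>l\<in>{..k}. zp (Suc k - l) \<odot> ?N l (Suc k - l))
      = (\<Oplus>l\<in>{..Suc k}. zp (Suc k - l) \<odot> ?N l (Suc k - l))"
    by (subst finsum_Suc) (auto simp del: add.nat_pow_Suc R.add.nat_pow_Suc)
  also have "(\<Oplus>l\<in>{..Suc k}. zp l \<odot> ?N l (Suc k - l))
      \<oplus> (\<Oplus>l\<in>{..Suc k}. zp (Suc k - l) \<odot> ?N l (Suc k - l))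
    = (\<Oplus>l\<in>{..Suc k}. zp l \<odot> ?N l (Suc k - l) \<oplus> zp (Suc k - l) \<odot> ?N l (Suc k - l))"
    by (subst finsum_addf) (auto simp del: add.nat_pow_Suc R.add.nat_pow_Suc)
  also have "\<dots> = (\<Oplus>l\<in>{..Suc k}. zp (Suc k) \<odot> ?N l (Suc k - l))"
    by (rule finsum_cong')
      (auto simp: smult_l_distr[symmetric] zp_add[symmetric] simp del: add.nat_pow_Suc R.add.nat_pow_Suc)
  also have "\<dots> = zp (Suc k) \<odot> ?SN'"
    by (rule finsum_smult_ldistr[symmetric]) auto
  also have "(\<Oplus>l\<in>{..k}. zp k \<odot> ?N l (k - l)) = zp k \<odot> ?SN"
    by (rule finsum_smult_ldistr[symmetric]) auto
  also have "\<ominus> d (snd (z k \<otimes>\<^bsub>B\<^esub> b)) = zp (Suc k) \<odot> (\<ominus> d (snd (z (Suc k)))) \<oplus> zp k \<odot> ?SN"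
    by (simp add: zb SN d_add d_smult smult_r_minus minus_add a_comm del: add.nat_pow_Suc R.add.nat_pow_Suc)
  finally have "zp (Suc k) \<odot> (\<ominus> d (snd (z (Suc k)))) = zp (Suc k) \<odot> ?SN'"
    by (subst (asm) add.right_cancel) (auto intro!: smult_closed finsum_closed)
  moreover have "zp (Suc k) \<in> Units (Zp p)"
    using Suc.prems zp_unit[OF assms(1), of "Suc k"] by simp
  ultimately have "?SN' = \<ominus> d (snd (z (Suc k)))"
    by (rule smult_unit_cancel[symmetric, rotated 3]) (auto intro!: finsum_closed)
  moreover have "(\<Oplus>\<^bsub>B\<^esub>l\<in>{..Suc k}. fst (z l) \<odot>\<^bsub>B\<^esub> z (Suc k - l)) = z (Suc k)"
    "(\<Oplus>\<^bsub>B\<^esub>l\<in>{..Suc k}. fst (z (Suc k - l)) \<odot>\<^bsub>B\<^esub> z l) = z (Suc k)"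
    unfolding z_def by (rule zeta_counit[OF assms(1) Suc.prems assms(3)])+
  ultimately show ?case
    using zc by (simp add: coproduct_family_def del: finsum_Suc B.finsum_Suc)
qed

lemma zeta_multi_Suc:
  assumes "\<And>j. j \<in> {1..Suc n} \<Longrightarrow> zeta p B (J j) (b j) \<in> carrier B"
  shows "zeta_multi p B (Suc n) J b = zeta p B (J (Suc n)) (b (Suc n)) \<otimes>\<^bsub>B\<^esub> zeta_multi p B n J b"
proof -
  have "{1..Suc n} = insert (Suc n) {1..n}"
    by auto
  then show ?thesis
    unfolding zeta_multi_def using assms by (simp add: Pi_def)
qed

lemma zeta_multi_cong:
  assumes "\<And>j. j \<in> {1..n} \<Longrightarrow> zeta p B (J j) (b j) \<in> carrier B" "\<And>j. j \<in> {1..n} \<Longrightarrow> J' j = J j"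
  shows "zeta_multi p B n J' b = zeta_multi p B n J b"
  unfolding zeta_multi_def using assms by (intro B.finprod_cong') auto

lemma zeta_multi_eq_one:
  assumes "\<And>j. j \<in> {1..n} \<Longrightarrow> J j = 0"
  shows "zeta_multi p B n J b = \<one>\<^bsub>B\<^esub>"
  unfolding zeta_multi_def using assms by (intro B.finprod_one_eqI) (simp add: zeta_0)

lemma zeta_multi_closed:
  assumes "\<And>j. j \<in> {1..n} \<Longrightarrow> zeta p B (J j) (b j) \<in> carrier B"
  shows "zeta_multi p B n J b \<in> carrier B"
  unfolding zeta_multi_def using assms by (intro B.finprod_closed) auto

lemma fst_zeta_multi:
  assumes "prime p" "\<And>j. j \<in> {1..n} \<Longrightarrow> J j < p" "\<And>j. j \<in> {1..n} \<Longrightarrow> a j \<in> G 1"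
    and "\<exists>j\<in>{1..n}. J j \<noteq> 0"
  shows "fst (zeta_multi p B n J (\<lambda>j. (\<zero>\<^bsub>Zp p\<^esub>, a j))) = \<zero>\<^bsub>Zp p\<^esub>"
  using assms(2-)
proof (induction n)
  case (Suc n)
  let ?b = "\<lambda>j. (\<zero>\<^bsub>Zp p\<^esub>, a j)"
  have zc: "zeta p B (J j) (?b j) \<in> carrier B" if "j \<in> {1..Suc n}" for j
    using assms(1) Suc.prems that by (intro zeta_closed) (auto simp: B_sel)
  have c: "fst (zeta_multi p B n J ?b) \<in> carrier (Zp p)"
    "fst (zeta p B (J (Suc n)) (?b (Suc n))) \<in> carrier (Zp p)"
    using zc by (auto intro!: fst_snd_B(1) zeta_multi_closed)
  have "fst (zeta_multi p B n J ?b) = \<zero>\<^bsub>Zp p\<^esub> \<or> fst (zeta p B (J (Suc n)) (?b (Suc n))) = \<zero>\<^bsub>Zp p\<^esub>"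
  proof (cases "J (Suc n) = 0")
    case True
    then have "\<exists>j\<in>{1..n}. J j \<noteq> 0"
      using Suc.prems(3) by (metis atLeastAtMost_iff le_Suc_eq)
    then show ?thesis
      using Suc by auto
  next
    case False
    then show ?thesis
      using fst_zeta[OF assms(1), of "J (Suc n)" "a (Suc n)"] Suc.prems by auto
  qed
  moreover have "zeta_multi p B (Suc n) J ?b = zeta p B (J (Suc n)) (?b (Suc n)) \<otimes>\<^bsub>B\<^esub> zeta_multi p B n J ?b"
    by (intro zeta_multi_Suc zc)
  ultimately show ?case
    using c by (auto simp only: B_sel(6) R.l_null R.r_null)
qed simp

text \<open>The family for \<open>\<zeta>\<^sub>I\<close> is the product of the families for its factors. It is indexed by all
  multi-indices \<open>J \<le> I\<close>, the second entry being \<open>\<zeta>\<close> of \<open>I - J\<close>; this includes \<open>J = 0\<close> and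
  \<open>J = I\<close>.\<close>

lemma coproduct_family_zeta_multi:
  assumes "prime p" "\<And>j. j \<in> {1..n} \<Longrightarrow> I j < p"
    and "\<And>j. j \<in> {1..n} \<Longrightarrow> a j \<in> G 1" "\<And>j. j \<in> {1..n} \<Longrightarrow> d (a j) = \<zero>"
  defines "b \<equiv> \<lambda>j. (\<zero>\<^bsub>Zp p\<^esub>, a j)"
  shows "coproduct_family (Pi\<^sub>E {1..n} (\<lambda>j. {..I j})) (\<lambda>J. zeta_multi p B n J b)
    (\<lambda>J. zeta_multi p B n (\<lambda>j. I j - J j) b) (zeta_multi p B n I b)"
  using assms(2-4)
proof (induction n)
  case 0
  have "zeta_multi p B 0 J b = \<one>\<^bsub>B\<^esub>" for J
    by (rule zeta_multi_eq_one) simp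
  then show ?case
    using coproduct_family_unit by simp
next
  case (Suc n)
  have zc: "zeta p B k (b j) \<in> carrier B" if "j \<in> {1..Suc n}" "k \<le> I j" for j k
    using assms(1) Suc.prems(1,2)[of j] that by (intro zeta_closed) (auto simp: B_sel b_def)
  have dom: "{1..Suc n} = insert (Suc n) {1..n}"
    by auto
  let ?S = "{..I (Suc n)} \<times> Pi\<^sub>E {1..n} (\<lambda>j. {..I j})"
  let ?h = "\<lambda>(l, J). J(Suc n := l)"
  have fam: "coproduct_family ?S
      (\<lambda>z. zeta p B (fst z) (b (Suc n)) \<otimes>\<^bsub>B\<^esub> zeta_multi p B n (snd z) b)
      (\<lambda>z. zeta p B (I (Suc n) - fst z) (b (Suc n)) \<otimes>\<^bsub>B\<^esub> zeta_multi p B n (\<lambda>j. I j - snd z j) b)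
      (zeta_multi p B (Suc n) I b)"
  proof -
    have "zeta_multi p B (Suc n) I b = zeta p B (I (Suc n)) (b (Suc n)) \<otimes>\<^bsub>B\<^esub> zeta_multi p B n I b"
      by (intro zeta_multi_Suc zc) auto
    moreover have "coproduct_family {..I (Suc n)} (\<lambda>l. zeta p B l (b (Suc n)))
        (\<lambda>l. zeta p B (I (Suc n) - l) (b (Suc n))) (zeta p B (I (Suc n)) (b (Suc n)))"
      unfolding b_def using Suc.prems assms(1) by (intro coproduct_family_zeta) auto
    moreover have "coproduct_family (Pi\<^sub>E {1..n} (\<lambda>j. {..I j})) (\<lambda>J. zeta_multi p B n J b)
        (\<lambda>J. zeta_multi p B n (\<lambda>j. I j - J j) b) (zeta_multi p B n I b)"
      using Suc.prems by (intro Suc.IH) auto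
    ultimately show ?thesis
      using coproduct_family_mult by fastforce
  qed
  have "coproduct_family (?h ` ?S) (\<lambda>J. zeta_multi p B (Suc n) J b)
      (\<lambda>J. zeta_multi p B (Suc n) (\<lambda>j. I j - J j) b) (zeta_multi p B (Suc n) I b)"
  proof (rule coproduct_family_reindex[OF fam])
    show "inj_on ?h ?S"
      by (rule inj_combinator) simp
    fix z assume z: "z \<in> ?S"
    then obtain l J where lJ: "z = (l, J)" "l \<le> I (Suc n)" "\<And>j. j \<in> {1..n} \<Longrightarrow> J j \<le> I j"
      by (auto simp: PiE_def Pi_def)
    let ?J = "J(Suc n := l)"
    have J: "?J j \<le> I j" if "j \<in> {1..Suc n}" for j
      using lJ that by (auto simp: dom)
    have "zeta_multi p B n ?J b = zeta_multi p B n J b"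
      "zeta_multi p B n (\<lambda>j. I j - ?J j) b = zeta_multi p B n (\<lambda>j. I j - J j) b"
      using lJ zc by (auto intro!: zeta_multi_cong)
    moreover have "zeta_multi p B (Suc n) ?J b = zeta p B (?J (Suc n)) (b (Suc n)) \<otimes>\<^bsub>B\<^esub> zeta_multi p B n ?J b"
      using J by (intro zeta_multi_Suc zc)
    moreover have "zeta_multi p B (Suc n) (\<lambda>j. I j - ?J j) b
      = zeta p B (I (Suc n) - ?J (Suc n)) (b (Suc n)) \<otimes>\<^bsub>B\<^esub> zeta_multi p B n (\<lambda>j. I j - ?J j) b"
      using J by (intro zeta_multi_Suc zc) auto
    ultimately show
      "zeta_multi p B (Suc n) (?h z) b = zeta p B (fst z) (b (Suc n)) \<otimes>\<^bsub>B\<^esub> zeta_multi p B n (snd z) b"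
      "zeta_multi p B (Suc n) (\<lambda>j. I j - ?h z j) b
        = zeta p B (I (Suc n) - fst z) (b (Suc n)) \<otimes>\<^bsub>B\<^esub> zeta_multi p B n (\<lambda>j. I j - snd z j) b"
      by (simp_all add: lJ(1))
  qed
  then show ?case
    unfolding dom PiE_insert_eq .
qed

section \<open>The differential of zeta elements\<close>

lemma to_dga_eq_snd:
  assumes "x \<in> carrier B" "fst x = \<zero>\<^bsub>Zp p\<^esub>"
  shows "to_dga A x = snd x"
  using assms fst_snd_B(2)[OF assms(1)] G_carrier[of "snd x" 1]
  by (simp add: to_dga_def split_beta)

lemma d_zeta:
  assumes "prime p" "a \<in> G 1" "d a = \<zero>" "1 \<le> k" "k < p"
  shows "d (zeta_dga p A G cup1 k a) =
    \<ominus> (\<Oplus>l\<in>{1..k - 1}. zeta_dga p A G cup1 l a \<otimes> zeta_dga p A G cup1 (k - l) a)"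
proof -
  define z where "z n = zeta p B n (\<zero>\<^bsub>Zp p\<^esub>, a)" for n
  have zc: "z n \<in> carrier B" if "n \<le> k" for n
    unfolding z_def using assms that by (intro zeta_closed) (auto simp: B_sel)
  have sz: "snd (z n) \<in> carrier A" if "n \<le> k" for n
    using zc[OF that] fst_snd_B(2) G_carrier[of _ 1] by blast
  have zd: "zeta_dga p A G cup1 n a = snd (z n)" if "1 \<le> n" "n \<le> k" for n
    unfolding zeta_dga_def z_def[symmetric] using that zc assms fst_zeta[OF assms(1) _ assms(2), of n]
    by (intro to_dga_eq_snd) (auto simp: z_def)
  have z0: "snd (z 0) = \<zero>"
    by (simp add: z_def zeta_0 B_sel(2))
  have "(\<Oplus>l\<in>{..k}. snd (z l) \<otimes> snd (z (k - l))) = \<ominus> d (snd (z k))"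
    using coproduct_family_sums(4)[OF coproduct_family_zeta[OF assms(1,5,2,3)]]
    by (simp add: z_def)
  \<comment> \<open>The terms \<open>l = 0\<close> and \<open>l = k\<close> vanish, since \<open>\<zeta>\<^sub>0(a) = 1\<close> has \<open>A\<^sup>1\<close>-component 0.\<close>
  moreover have "(\<Oplus>l\<in>{1..k - 1}. snd (z l) \<otimes> snd (z (k - l))) = (\<Oplus>l\<in>{..k}. snd (z l) \<otimes> snd (z (k - l)))"
  proof (rule add.finprod_mono_neutral_cong_left)
    fix l assume "l \<in> {..k} - {1..k - 1}"
    then have "l = 0 \<or> l = k"
      by auto
    then show "snd (z l) \<otimes> snd (z (k - l)) = \<zero>"
      using z0 sz[of k] by auto
  qed (use sz in auto)
  moreover have "d (snd (z k)) \<in> carrier A"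
    using zc[of k] fst_snd_B(2)[of "z k"] d_G2 G_carrier[of _ 2] by blast
  ultimately have "d (snd (z k)) = \<ominus> (\<Oplus>l\<in>{1..k - 1}. snd (z l) \<otimes> snd (z (k - l)))"
    by simp
  also have "(\<Oplus>l\<in>{1..k - 1}. snd (z l) \<otimes> snd (z (k - l)))
      = (\<Oplus>l\<in>{1..k - 1}. zeta_dga p A G cup1 l a \<otimes> zeta_dga p A G cup1 (k - l) a)"
    using sz by (intro finsum_cong') (auto simp: zd)
  finally show ?thesis
    using assms(4) by (simp add: zd)
qed

text \<open>A splitting \<open>I = J + K\<close> is determined by \<open>J\<close>.\<close>

lemma splittings_eq:
  "splittings n I = (\<lambda>J. (J, \<lambda>j\<in>{1..n}. I j - J j)) `
     {J \<in> Pi\<^sub>E {1..n} (\<lambda>j. {..I j}). (\<exists>j\<in>{1..n}. J j \<noteq> 0) \<and> (\<exists>j\<in>{1..n}. I j - J j \<noteq> 0)}"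
  (is "_ = ?h ` ?T")
proof (intro equalityI subsetI)
  fix S assume "S \<in> splittings n I"
  then obtain J K where S: "S = (J, K)" "J \<in> {1..n} \<rightarrow>\<^sub>E UNIV" "K \<in> {1..n} \<rightarrow>\<^sub>E UNIV"
    "\<forall>j\<in>{1..n}. J j + K j = I j" "\<exists>j\<in>{1..n}. J j \<noteq> 0" "\<exists>j\<in>{1..n}. K j \<noteq> 0"
    by (auto simp: splittings_def)
  then have K: "K j = I j - J j" "J j \<le> I j" if "j \<in> {1..n}" for j
    using that by (metis add_diff_cancel_left' le_add1)+
  have "K = (\<lambda>j\<in>{1..n}. I j - J j)"
    using S(3) K(1) by (intro extensionalityI[of _ "{1..n}"]) (auto simp: PiE_def)
  moreover have "J \<in> ?T"
    using S K by (auto simp: PiE_iff)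
  ultimately show "S \<in> ?h ` ?T"
    using S(1) by blast
next
  fix S assume "S \<in> ?h ` ?T"
  then show "S \<in> splittings n I"
    by (force simp: splittings_def PiE_iff)
qed

text \<open>The terms \<open>J = 0\<close> and \<open>J = I\<close> of the coproduct family do not contribute, since the
  \<open>A\<^sup>1\<close>-component of the unit is 0. On all other terms, the \<open>A\<^sup>1\<close>-component is the whole element.\<close>

lemma d_zeta_multi:
  assumes "prime p" "1 \<le> n" "\<And>j. j \<in> {1..n} \<Longrightarrow> 1 \<le> I j" "\<And>j. j \<in> {1..n} \<Longrightarrow> I j < p"
    and "\<And>j. j \<in> {1..n} \<Longrightarrow> a j \<in> G 1" "\<And>j. j \<in> {1..n} \<Longrightarrow> d (a j) = \<zero>"
  shows "d (zeta_multi_dga p A G cup1 n I a) =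
    \<ominus> (\<Oplus>S\<in>splittings n I. zeta_multi_dga p A G cup1 n (fst S) a \<otimes> zeta_multi_dga p A G cup1 n (snd S) a)"
proof -
  define b where "b = (\<lambda>j. (\<zero>\<^bsub>Zp p\<^esub>, a j))"
  define z where "z J = zeta_multi p B n J b" for J
  have ec: "zeta p B k (b j) \<in> carrier B" if "j \<in> {1..n}" "k \<le> I j" for j k
    using assms(1) assms(4,5)[of j] that by (intro zeta_closed) (auto simp: B_sel b_def)
  have zc: "z J \<in> carrier B" if "\<And>j. j \<in> {1..n} \<Longrightarrow> J j \<le> I j" for J
    unfolding z_def using that by (intro zeta_multi_closed ec)
  have sz: "snd (z J) \<in> carrier A" if "\<And>j. j \<in> {1..n} \<Longrightarrow> J j \<le> I j" for J
    using zc[OF that] fst_snd_B(2) G_carrier[of _ 1] by blast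
  have zd: "zeta_multi_dga p A G cup1 n J a = snd (z J)"
    if "\<And>j. j \<in> {1..n} \<Longrightarrow> J j \<le> I j" "\<exists>j\<in>{1..n}. J j \<noteq> 0" for J
  proof -
    have "J j < p" if "j \<in> {1..n}" for j
      using assms(4) \<open>\<And>j. j \<in> {1..n} \<Longrightarrow> J j \<le> I j\<close> that by (meson le_less_trans)
    then have "fst (z J) = \<zero>\<^bsub>Zp p\<^esub>"
      unfolding z_def b_def using assms that by (intro fst_zeta_multi) auto
    then show ?thesis
      unfolding zeta_multi_dga_def using zc[OF that(1)]
      by (simp add: z_def b_def[symmetric] to_dga_eq_snd)
  qed
  have z0: "snd (z J) = \<zero>" if "\<And>j. j \<in> {1..n} \<Longrightarrow> J j = 0" for J
    using zeta_multi_eq_one[of n J b] that unfolding z_def by (simp add: B_sel(2))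
  let ?P = "Pi\<^sub>E {1..n} (\<lambda>j. {..I j})"
  let ?T = "{J \<in> ?P. (\<exists>j\<in>{1..n}. J j \<noteq> 0) \<and> (\<exists>j\<in>{1..n}. I j - J j \<noteq> 0)}"
  let ?N = "\<lambda>J. snd (z J) \<otimes> snd (z (\<lambda>j. I j - J j))"
  let ?h = "\<lambda>J. (J, \<lambda>j\<in>{1..n}. I j - J j)"
  let ?M = "\<lambda>S. zeta_multi_dga p A G cup1 n (fst S) a \<otimes> zeta_multi_dga p A G cup1 n (snd S) a"
  have NP: "snd (z J) \<in> carrier A" "snd (z (\<lambda>j. I j - J j)) \<in> carrier A" if "J \<in> ?P" for J
    using that by (auto intro!: sz)
  have MN: "?M (?h J) = ?N J" if "J \<in> ?T" for J
  proof -
    have "z (\<lambda>j\<in>{1..n}. I j - J j) = z (\<lambda>j. I j - J j)"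
      unfolding z_def by (intro zeta_multi_cong ec) auto
    moreover have "zeta_multi_dga p A G cup1 n (\<lambda>j\<in>{1..n}. I j - J j) a = snd (z (\<lambda>j\<in>{1..n}. I j - J j))"
      using that by (intro zd) auto
    moreover have "zeta_multi_dga p A G cup1 n J a = snd (z J)"
      using that by (intro zd) auto
    ultimately show ?thesis
      by simp
  qed
  have "finsum A ?M (splittings n I) = (\<Oplus>J\<in>?T. ?M (?h J))"
    unfolding splittings_eq
  proof (rule finsum_reindex)
    show "?M \<in> ?h ` ?T \<rightarrow> carrier A"
    proof (intro funcsetI)
      fix S assume "S \<in> ?h ` ?T"
      then obtain J where "J \<in> ?T" "S = ?h J"
        by blast
      then show "?M S \<in> carrier A"
        using MN[of J] NP[of J] by (simp only: mem_Collect_eq m_closed)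
    qed
  qed (auto simp: inj_on_def)
  also have "\<dots> = finsum A ?N ?T"
    using MN NP by (intro finsum_cong') auto
  also have "\<dots> = finsum A ?N ?P"
  proof (rule add.finprod_mono_neutral_cong_left)
    fix J assume J: "J \<in> ?P - ?T"
    then consider "\<And>j. j \<in> {1..n} \<Longrightarrow> J j = 0" | "\<And>j. j \<in> {1..n} \<Longrightarrow> I j - J j = 0"
      by blast
    then show "?N J = \<zero>"
    proof cases
      case 1
      then have "snd (z J) = \<zero>"
        by (rule z0)
      then show ?thesis
        using J NP[of J] by simp
    next
      case 2
      then have "snd (z (\<lambda>j. I j - J j)) = \<zero>"
        by (rule z0)
      then show ?thesis
        using J NP[of J] by simp
    qed
  qed (use NP in \<open>auto intro!: finite_PiE\<close>)
  also have "\<dots> = \<ominus> d (snd (z I))"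
    unfolding z_def b_def using assms
    by (intro coproduct_family_sums(4) coproduct_family_zeta_multi) auto
  finally have "finsum A ?M (splittings n I) = \<ominus> d (snd (z I))" .
  moreover have "d (snd (z I)) \<in> carrier A"
    using zc[of I] fst_snd_B(2)[of "z I"] d_G2 G_carrier[of _ 2] by blast
  moreover have "zeta_multi_dga p A G cup1 n I a = snd (z I)"
  proof (rule zd)
    show "\<exists>j\<in>{1..n}. I j \<noteq> 0"
      using assms(2) assms(3)[of 1] by (intro bexI[of _ 1]) auto
  qed simp
  ultimately show ?thesis
    by simp
qed

end

theorem theorem8p9:
  fixes p :: nat
    and A :: "(int, 'a, 'm) module_scheme"
    and G :: "nat \<Rightarrow> 'a set"
    and d :: "'a \<Rightarrow> 'a"
    and cup1 :: "'a \<Rightarrow> 'a \<Rightarrow> 'a"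
  assumes "prime p"
    and "binomial_cup1_dga p A G d cup1"
  shows "(\<forall>a \<in> Z1 A G d. \<forall>k. 1 \<le> k \<and> k \<le> p - 1 \<longrightarrow>
           d (zeta_dga p A G cup1 k a) =
             \<ominus>\<^bsub>A\<^esub> (\<Oplus>\<^bsub>A\<^esub>l\<in>{1..k - 1}. zeta_dga p A G cup1 l a \<otimes>\<^bsub>A\<^esub> zeta_dga p A G cup1 (k - l) a))
       \<and> (\<forall>n I a. 1 \<le> n \<and> (\<forall>j\<in>{1..n}. 1 \<le> I j \<and> I j \<le> p - 1) \<and> (\<forall>j\<in>{1..n}. a j \<in> Z1 A G d) \<longrightarrow>
           d (zeta_multi_dga p A G cup1 n I a) =
             \<ominus>\<^bsub>A\<^esub> (\<Oplus>\<^bsub>A\<^esub>S\<in>splittings n I.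
                   zeta_multi_dga p A G cup1 n (fst S) a \<otimes>\<^bsub>A\<^esub> zeta_multi_dga p A G cup1 n (snd S) a))"
proof -
  interpret binomial_cup1_dga p A G d cup1
    by fact
  have less: "k < p" if "k \<le> p - 1" for k
    using that prime_gt_0_nat[OF assms(1)] by linarith
  show ?thesis
    using assms(1) less by (auto simp: Z1_def intro!: d_zeta d_zeta_multi)
qed

end
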